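(* Let $n\in\mathbb N$, $\alpha>0$, $1<p<\infty$ and $\frac1p+\frac1{p'}=1$. Let $\mathcal{M}^n$ denote the set of holomorphic monomials $z\mapsto z^{\mathbf j}=z_1^{j_1}\cdots z_n^{j_n}$ on $\mathbb C^n$, $\mathbf j\in(\mathbb N\cup\{0\})^n$. Then \[ \sup_{g\in\mathcal{H}^n_{p,\alpha}\setminus\{0\}}\ \sup_{h\in\mathcal{M}^n}\mathcal{R}_{p,\alpha}(g,h)=C_p^{n/2}, \qquad \mathcal{R}_{p,\alpha}(g,h)=\frac{|\langle g,h\rangle_\alpha|}{\|g\|_{p,\alpha}\|h\|_{p',\alpha}}. \]
   Context: For $\alpha>0$ and $n\in\mathbb N$, $\gamma^n_\alpha(dz)=(\alpha/\pi)^n e^{-\alpha|z|^2}\lambda^n(dz)$ on $\mathbb C^n$, with $\lambda^n$ Lebesgue measure. For $1\le p<\infty$, $\mathcal{H}^n_{p,\alpha}$ is the space of holomorphic $f$ on $\mathbb C^n$ with $\|f\|_{p,\alpha}:=\left(\int|f|^p\,d\gamma^n_{\alpha p/2}\right)^{1/p}<\infty$ (monomials belong to every $\mathcal{H}^n_{p,\alpha}$). $\langle f,g\rangle_\alpha=\int f\overline{g}\,d\gamma^n_\alpha$. $C_p=2\,p^{-1/p}\,(p')^{-1/p'}$. *)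

theory Defs
  imports "HOL-Analysis.Analysis"
begin

text \<open>C^n is modelled as complex ^ 'n for a finite index type 'n, n = CARD('n).
  Lebesgue measure on C^n = R^(2n) is lborel on this euclidean space.\<close>

definition gauss_measure :: "real \<Rightarrow> (complex ^ 'n::finite) measure" where
  "gauss_measure \<alpha> = density lborel
     (\<lambda>z. ennreal ((\<alpha> / pi) ^ CARD('n) * exp (- \<alpha> * (norm z)\<^sup>2)))"

text \<open>Holomorphic on C^n: complex (Frechet) differentiable everywhere, i.e. the real
  derivative is complex-linear.\<close>
definition holomorphic_n :: "(complex ^ 'n::finite \<Rightarrow> complex) \<Rightarrow> bool" where
  "holomorphic_n f \<longleftrightarrow> (\<forall>z. \<exists>L. (f has_derivative L) (at z) \<and>
      (\<forall>c v. L (c *s v) = c * L v))"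

definition fock_norm :: "real \<Rightarrow> real \<Rightarrow> (complex ^ 'n::finite \<Rightarrow> complex) \<Rightarrow> real" where
  "fock_norm p \<alpha> f = (\<integral>z. norm (f z) powr p \<partial>(gauss_measure (\<alpha> * p / 2))) powr (1 / p)"

definition fock_space :: "real \<Rightarrow> real \<Rightarrow> (complex ^ 'n::finite \<Rightarrow> complex) set" where
  "fock_space p \<alpha> = {f. holomorphic_n f \<and>
      (\<integral>\<^sup>+ z. ennreal (norm (f z) powr p) \<partial>(gauss_measure (\<alpha> * p / 2))) < \<infinity>}"

definition fock_inner :: "real \<Rightarrow> (complex ^ 'n::finite \<Rightarrow> complex) \<Rightarrow> (complex ^ 'n \<Rightarrow> complex) \<Rightarrow> complex" where
  "fock_inner \<alpha> f g = (\<integral>z. f z * cnj (g z) \<partial>(gauss_measure \<alpha>))"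

definition monomials :: "(complex ^ 'n::finite \<Rightarrow> complex) set" where
  "monomials = {h. \<exists>j :: 'n \<Rightarrow> nat. h = (\<lambda>z. \<Prod>i\<in>UNIV. (z $ i) ^ j i)}"

definition C_const :: "real \<Rightarrow> real \<Rightarrow> real" where
  "C_const p p' = 2 * p powr (- 1 / p) * p' powr (- 1 / p')"

definition ratio_R :: "real \<Rightarrow> real \<Rightarrow> real \<Rightarrow> (complex ^ 'n::finite \<Rightarrow> complex) \<Rightarrow> (complex ^ 'n \<Rightarrow> complex) \<Rightarrow> real" where
  "ratio_R p p' \<alpha> g h = norm (fock_inner \<alpha> g h) / (fock_norm p \<alpha> g * fock_norm p' \<alpha> h)"

end

theory Submission
  imports Defs "HOL-Complex_Analysis.Complex_Analysis" "HOL-Real_Asymp.Real_Asymp"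
begin

text \<open>
  Averaging a holomorphic \<open>g\<close> over the torus against the character of \<open>z^j\<close> leaves \<open>c z^j\<close>, so
  integrating \<open>g\<close> against \<open>cnj (z^j)\<close> times any torus-invariant weight \<open>V\<close> gives
  \<open>c\<close> times the integral of \<open>|z^j|^2 V\<close>. For \<open>V = 1\<close> this evaluates the pairing; for
  \<open>V = |z^j|^(p-2)\<close> Hoelder's inequality bounds \<open>|c|\<close> by the quotient of the norms of \<open>g\<close> and \<open>z^j\<close>.
  Hence the best \<open>g\<close> for \<open>h = z^j\<close> is \<open>z^j\<close> itself, and the ratio is the product over the coordinates
  of an explicit quotient of Gamma values. In terms of the Binet function \<open>\<mu>\<close>, the logarithm of the
  quotient with exponent \<open>k\<close> is \<open>ln C / 2 + \<mu> k - \<mu> (k p / 2) / p - \<mu> (k p' / 2) / p'\<close>: the upper bound is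
  Jensen's inequality for the convex \<open>\<mu>\<close>, and it is attained in the limit \<open>k \<rightarrow> \<infinity>\<close> because
  \<open>\<mu>\<close> converges.
\<close>

section \<open>Convexity of the Binet function\<close>

text \<open>Telescoping comparison with the series of \<open>1 / (x + n)^2\<close>:
  \<open>F n\<close> is minus the bound at \<open>x + n\<close>, so the increments of
  \<open>F\<close> sum to the bound at \<open>x\<close>, and each falls short of the corresponding
  series term by half a square.\<close>

lemma Polygamma_1_ge:
  fixes x :: real assumes "x > 0"
  shows "Polygamma 1 x \<ge> 1 / x + 1 / (2 * x\<^sup>2)"
proof -
  define F where "F n = - (1 / (x + real n) + 1 / (2 * (x + real n)\<^sup>2))" for n
  have "F \<longlonglongrightarrow> 0"
    unfolding F_def by real_asymp
  hence S1: "(\<lambda>n. F (Suc n) - F n) sums (0 - F 0)" by (rule telescope_sums)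
  have S2: "(\<lambda>n. inverse ((x + real n)\<^sup>2)) sums Polygamma 1 x"
    using Polygamma_converges'[of x 2] assms by (simp add: Polygamma_def sums_iff numeral_2_eq_2)
  have le: "F (Suc n) - F n \<le> inverse ((x + real n)\<^sup>2)" for n
  proof -
    define y where "y = x + real n"
    have y: "y > 0" using assms by (simp add: y_def)
    have Suc: "x + real (Suc n) = y + 1" by (simp add: y_def)
    have "F (Suc n) - F n = inverse (y\<^sup>2) - (1 / y - 1 / (y + 1))\<^sup>2 / 2"
      unfolding F_def Suc y_def[symmetric] using y
      by (simp add: divide_simps power2_eq_square) (simp add: algebra_simps)
    thus ?thesis by (simp add: y_def)
  qed
  from sums_le[OF le S1 S2] show ?thesis by (simp add: F_def)
qed

text \<open>Binet's function up to the additive constant \<open>ln (2 * pi) / 2\<close>, which Jensen's inequality does not see.\<close>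

definition Binet :: "real \<Rightarrow> real" where
  "Binet x = ln_Gamma x - (x - 1 / 2) * ln x + x"

lemma convex_on_Binet: "convex_on {0<..} Binet"
proof (rule f''_ge0_imp_convex)
  fix x :: real assume x: "x \<in> {0<..}"
  show "DERIV Binet x :> Digamma x - ln x + 1 / (2 * x)"
    unfolding Binet_def[abs_def] using x
    by (auto intro!: derivative_eq_intros simp: field_simps)
  show "DERIV (\<lambda>x. Digamma x - ln x + 1 / (2 * x)) x :> Polygamma 1 x - 1 / x - 1 / (2 * x\<^sup>2)"
    using x by (auto intro!: derivative_eq_intros elim!: nonpos_Ints_cases simp: field_simps power2_eq_square)
  show "0 \<le> Polygamma 1 x - 1 / x - 1 / (2 * x\<^sup>2)"
    using Polygamma_1_ge[of x] x by simp
qed simp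

lemma ln_Gamma_real_plus1:
  fixes x :: real assumes "x > 0"
  shows "ln_Gamma (x + 1) = ln_Gamma x + ln x"
proof -
  have "x \<notin> \<int>\<^sub>\<le>\<^sub>0" using assms by (auto elim!: nonpos_Ints_cases)
  thus ?thesis using assms Gamma_real_pos[OF assms]
    by (simp add: ln_Gamma_real_pos Gamma_plus1 ln_mult_pos)
qed

text \<open>The decrement is \<open>x + 1 / 2\<close> times the integral of \<open>1 / t\<close>
  over \<open>[x, x + 1]\<close>, minus 1. As \<open>1 / t\<close> is convex, the midpoint rule
  bounds the integral from below and the trapezoidal rule from above; the upper bound is written so
  that it telescopes.\<close>

lemma Binet_step:
  assumes "x > 0"
  shows "Binet (x + 1) \<le> Binet x" "Binet x - Binet (x + 1) \<le> 1 / 4 * (1 / x - 1 / (x + 1))"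
proof -
  have eq: "Binet x - Binet (x + 1) = (x + 1 / 2) * (ln (x + 1) - ln x) - 1"
    using ln_Gamma_real_plus1[OF assms] by (simp add: Binet_def algebra_simps)
  have "ln (x + 1) - ln x \<ge> 2 / (2 * x + 1)"
    using ln_inverse_approx_ge[of x "x + 1"] assms by simp
  hence "(x + 1 / 2) * (ln (x + 1) - ln x) \<ge> (x + 1 / 2) * (2 / (2 * x + 1))"
    using assms by (intro mult_left_mono) auto
  also have "(x + 1 / 2) * (2 / (2 * x + 1)) = 1" using assms by (simp add: field_simps)
  finally show "Binet (x + 1) \<le> Binet x" using eq by simp
  have "(x + 1 / 2) * (ln (x + 1) - ln x) \<le> (x + 1 / 2) * ((inverse x + inverse (x + 1)) / 2)"
    using ln_inverse_approx_le[of x 1] assms by (intro mult_left_mono) auto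
  also have "\<dots> = 1 + 1 / 4 * (1 / x - 1 / (x + 1))"
    using assms by (simp add: divide_simps) (simp add: algebra_simps)
  finally show "Binet x - Binet (x + 1) \<le> 1 / 4 * (1 / x - 1 / (x + 1))" unfolding eq by linarith
qed

text \<open>Convexity turns decrease over unit steps into decrease everywhere: \<open>y\<close> lies
  between \<open>x\<close> and \<open>y + 1\<close>, so a rise from \<open>x\<close> to
  \<open>y\<close> would force a rise from \<open>y\<close> to \<open>y + 1\<close>.\<close>

lemma Binet_antimono:
  assumes "0 < x" "x \<le> y"
  shows "Binet y \<le> Binet x"
proof (cases "x = y")
  case False
  hence xy: "x < y" using assms by simp
  \<comment> \<open>The solution of \<open>(1 - t) * (y + 1) + t * x = y\<close>.\<close>
  define t where "t = 1 / (y + 1 - x)"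
  have t: "0 < t" "t < 1" using xy by (auto simp: t_def)
  have y: "(1 - t) *\<^sub>R (y + 1) + t *\<^sub>R x = y" using xy by (simp add: t_def divide_simps) (simp add: algebra_simps)
  have "Binet ((1 - t) *\<^sub>R (y + 1) + t *\<^sub>R x) \<le> (1 - t) * Binet (y + 1) + t * Binet x"
    using t assms by (intro convex_onD[OF convex_on_Binet]) auto
  also have "\<dots> \<le> (1 - t) * Binet y + t * Binet x"
    using Binet_step(1)[of y] t assms by (intro add_right_mono mult_left_mono) auto
  finally have "t * Binet y \<le> t * Binet x" unfolding y by (simp add: algebra_simps)
  thus ?thesis using t by simp
qed simp

text \<open>The telescoping decrements from 1 onwards add up to at most 1/4 at integers;
  monotonicity carries the bound from an integer beyond \<open>x\<close> back to
  \<open>x\<close>.\<close>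

lemma Binet_ge: 
  assumes "x \<ge> 1"
  shows "Binet x \<ge> Binet 1 - 1 / 4"
proof -
  have n: "Binet (real (Suc n)) \<ge> Binet 1 - 1 / 4 * (1 - 1 / real (Suc n))" for n
  proof (induction n)
    case (Suc n)
    have "real (Suc (Suc n)) = real (Suc n) + 1" by simp
    thus ?case using Suc Binet_step(2)[of "real (Suc n)"] unfolding right_diff_distrib by simp
  qed simp
  obtain n where "x \<le> real n" using real_arch_simple[of x] by blast
  hence "Binet (real (Suc n)) \<le> Binet x" using assms by (intro Binet_antimono) auto
  moreover have "1 / 4 * (1 - 1 / real (Suc n)) \<le> 1 / 4" by simp
  ultimately show ?thesis using n[of n] by linarith
qed

text \<open>A decreasing function bounded below tends to its infimum. Existence is enough, because
  the limit cancels in \<open>Gamma_ratio_tendsto\<close>.\<close>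

lemma Binet_convergent: "\<exists>L. (Binet \<longlongrightarrow> L) at_top"
proof -
  define L where "L = Inf (Binet ` {1..})"
  have bdd: "bdd_below (Binet ` {1..})"
    using Binet_ge by (auto intro!: bdd_belowI)
  have "(Binet \<longlongrightarrow> L) at_top"
  proof (rule order_tendstoI)
    fix a assume "a < L"
    have "eventually (\<lambda>x. x \<ge> (1::real)) at_top" by (rule eventually_ge_at_top)
    thus "eventually (\<lambda>x. a < Binet x) at_top"
    proof eventually_elim
      case (elim x)
      thus ?case using cINF_lower[OF bdd, of x] \<open>a < L\<close> by (auto simp: L_def)
    qed
  next
    fix a assume "L < a"
    then obtain y where y: "y \<ge> 1" "Binet y < a"
      using cInf_lessD[of "Binet ` {1..}" a] by (auto simp: L_def)
    have "eventually (\<lambda>x. x \<ge> y) at_top" by (rule eventually_ge_at_top)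
    thus "eventually (\<lambda>x. Binet x < a) at_top"
    proof eventually_elim
      case (elim x)
      thus ?case using Binet_antimono[of y x] y by auto
    qed
  qed
  thus ?thesis by blast
qed

section \<open>Quotients of Gamma values\<close>

text \<open>The factor that a coordinate with exponent \<open>k\<close> contributes to the ratio at
  \<open>g = h = z^j\<close>; see \<open>monom_ratio_eq_prod\<close>.\<close>

definition Gamma_ratio :: "real \<Rightarrow> real \<Rightarrow> nat \<Rightarrow> real" where
  "Gamma_ratio p q k = fact k * (p / 2) powr (k / 2) * (q / 2) powr (k / 2) /
     (Gamma (k * p / 2 + 1) powr (1 / p) * Gamma (k * q / 2 + 1) powr (1 / q))"

lemma ln_Gamma_plus1_Binet:
  "x > 0 \<Longrightarrow> ln (Gamma (x + 1)) = Binet x + (x + 1 / 2) * ln x - x"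
  using ln_Gamma_real_plus1[of x] by (simp add: Binet_def ln_Gamma_real_pos algebra_simps)

lemma Gamma_ratio_pos:
  assumes "p > 0" "q > 0"
  shows "Gamma_ratio p q k > 0"
proof -
  have "Gamma (k * p / 2 + 1) > 0" "Gamma (k * q / 2 + 1) > 0"
    using assms by (auto intro!: Gamma_real_pos add_nonneg_pos)
  thus ?thesis using assms by (simp add: Gamma_ratio_def)
qed

lemma C_const_pos: "p > 0 \<Longrightarrow> q > 0 \<Longrightarrow> C_const p q > 0"
  by (simp add: C_const_def)

text \<open>Stirling's formula in exact form: once \<open>Binet\<close> carries the error terms, the
  leading parts of the three log-Gamma values combine to \<open>ln C / 2\<close>.\<close>

lemma ln_Gamma_ratio:
  assumes pq: "p > 0" "q > 0" "1 / p + 1 / q = 1" and "k > 0"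
  shows "ln (Gamma_ratio p q k) = ln (C_const p q) / 2
           + (Binet k - (Binet (k * p / 2) / p + Binet (k * q / 2) / q))"
proof -
  have G: "Gamma (k * p / 2 + 1) > 0" "Gamma (k * q / 2 + 1) > 0"
    using pq(1,2) \<open>k > 0\<close> by (auto intro!: Gamma_real_pos add_nonneg_pos)
  have fact: "ln (fact k) = Binet k + (k + 1 / 2) * ln k - k"
    using ln_Gamma_plus1_Binet[of "real k"] \<open>k > 0\<close> by (simp add: Gamma_fact add.commute)
  have ln2: "ln (p / 2) = ln p - ln 2" "ln (q / 2) = ln q - ln 2" using pq(1,2) by (simp_all add: ln_div)
  have C: "ln (C_const p q) = ln 2 - ln p / p - ln q / q"
    using pq(1,2) by (simp add: C_const_def ln_mult ln_powr)
  have "ln (Gamma_ratio p q k) = ln (fact k) + k / 2 * ln (p / 2) + k / 2 * ln (q / 2)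
     - (1 / p * ln (Gamma (k * p / 2 + 1)) + 1 / q * ln (Gamma (k * q / 2 + 1)))"
    using pq(1,2) \<open>k > 0\<close> G by (simp add: Gamma_ratio_def ln_mult ln_div ln_powr)
  also have "ln (Gamma (k * p / 2 + 1)) = Binet (k * p / 2) + (k * p / 2 + 1 / 2) * (ln k + ln p - ln 2) - k * p / 2"
    using pq(1,2) \<open>k > 0\<close> by (subst ln_Gamma_plus1_Binet) (auto simp: ln_mult ln_div)
  also have "ln (Gamma (k * q / 2 + 1)) = Binet (k * q / 2) + (k * q / 2 + 1 / 2) * (ln k + ln q - ln 2) - k * q / 2"
    using pq(1,2) \<open>k > 0\<close> by (subst ln_Gamma_plus1_Binet) (auto simp: ln_mult ln_div)
  also have "1 / p * (Binet (k * p / 2) + (k * p / 2 + 1 / 2) * (ln k + ln p - ln 2) - k * p / 2)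
     = Binet (k * p / 2) / p + k / 2 * (ln k + ln p - ln 2) + 1 / p / 2 * (ln k - ln 2) + ln p / p / 2 - k / 2"
    using pq(1,2) by (simp add: field_simps)
  also have "1 / q * (Binet (k * q / 2) + (k * q / 2 + 1 / 2) * (ln k + ln q - ln 2) - k * q / 2)
     = Binet (k * q / 2) / q + k / 2 * (ln k + ln q - ln 2) + 1 / q / 2 * (ln k - ln 2) + ln q / q / 2 - k / 2"
    using pq(1,2) by (simp add: field_simps)
  \<comment> \<open>Beyond the claim there remains a multiple of \<open>ln k - ln 2\<close>, whose
    coefficient vanishes because the exponents are conjugate.\<close>
  finally have "ln (Gamma_ratio p q k) = ln (C_const p q) / 2
           + (Binet k - (Binet (k * p / 2) / p + Binet (k * q / 2) / q))
           + (1 / 2 - (1 / p + 1 / q) / 2) * (ln k - ln 2)"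
    unfolding fact C ln2
    by argo
  thus ?thesis by (simp add: pq(3))
qed

lemma Gamma_ratio_le:
  assumes pq: "p > 0" "q > 0" "1 / p + 1 / q = 1"
  shows "Gamma_ratio p q k \<le> C_const p q powr (1 / 2)"
proof -
  have "1 / p > 0" "1 / q > 0" using pq(1,2) by simp_all
  hence q: "1 / q = 1 - 1 / p" "0 \<le> 1 / p" "1 / p \<le> 1" using pq(3) by linarith+
  have "ln (Gamma_ratio p q k) \<le> ln (C_const p q) / 2"
  proof (cases "k = 0")
    case False
    \<comment> \<open>Jensen: the points \<open>k * p / 2\<close> and \<open>k * q / 2\<close>,
      weighted by \<open>1 / p\<close> and \<open>1 / q\<close>, have mean \<open>k\<close>.\<close>
    have "Binet ((1 - 1 / p) *\<^sub>R (k * q / 2) + (1 / p) *\<^sub>R (k * p / 2))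
        \<le> (1 - 1 / p) * Binet (k * q / 2) + (1 / p) * Binet (k * p / 2)"
      using pq(1,2) q(2,3) False by (intro convex_onD[OF convex_on_Binet]) auto
    also have "(1 - 1 / p) *\<^sub>R (k * q / 2) + (1 / p) *\<^sub>R (k * p / 2) = real k"
      using pq(1,2) by (simp add: q(1)[symmetric])
    finally have "Binet k \<le> Binet (k * p / 2) / p + Binet (k * q / 2) / q"
      by (simp add: q(1)[symmetric] add.commute)
    moreover have "k > 0" using False by simp
    ultimately show ?thesis unfolding ln_Gamma_ratio[OF pq \<open>k > 0\<close>] by linarith
  next
    case True
    \<comment> \<open>For \<open>k = 0\<close> the arguments of \<open>Binet\<close> leave its
      domain of convexity. The quotient is then 1, and \<open>C \<ge> 1\<close> follows from
      concavity of \<open>ln\<close>: with the same weights, \<open>p\<close> and \<open>q\<close>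
      have mean 2.\<close>
    have "- ln ((1 - 1 / p) *\<^sub>R q + (1 / p) *\<^sub>R p) \<le> (1 - 1 / p) * (- ln q) + (1 / p) * (- ln p)"
      using pq(1,2) q(2,3) minus_log_convex[of "exp 1"]
      by (intro convex_onD[where f = "\<lambda>x. - ln x" and A = "{0<..}"]) (auto simp: log_ln)
    also have "(1 - 1 / p) *\<^sub>R q + (1 / p) *\<^sub>R p = 2"
      using pq(1,2) by (simp add: q(1)[symmetric])
    finally have "ln p / p + ln q / q \<le> ln 2" by (simp add: q(1)[symmetric])
    hence "ln (C_const p q) \<ge> 0"
      using pq(1,2) by (simp add: C_const_def ln_mult ln_powr)
    moreover have "Gamma_ratio p q k = 1" using True pq(1,2) by (simp add: Gamma_ratio_def)
    ultimately show ?thesis by simp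
  qed
  hence "ln (Gamma_ratio p q k) \<le> ln (C_const p q powr (1 / 2))"
    using C_const_pos[of p q] pq(1,2) by (simp add: ln_powr)
  thus ?thesis using Gamma_ratio_pos[of p q k] C_const_pos[of p q] pq(1,2)
    by (subst (asm) ln_le_cancel_iff) auto
qed

text \<open>All three \<open>Binet\<close> terms tend to the same \<open>L\<close>, and
  \<open>L - (L / p + L / q) = 0\<close>, so only \<open>ln C / 2\<close> survives.\<close>

lemma Gamma_ratio_tendsto:
  assumes pq: "p > 0" "q > 0" "1 / p + 1 / q = 1"
  shows "(\<lambda>k. Gamma_ratio p q k) \<longlonglongrightarrow> C_const p q powr (1 / 2)"
proof -
  obtain L where L: "(Binet \<longlongrightarrow> L) at_top" using Binet_convergent by blast
  have lim: "(\<lambda>k. Binet (real k * c)) \<longlonglongrightarrow> L" if "c > 0" for c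
    by (rule filterlim_compose[OF L]) (use that in real_asymp)
  have "(\<lambda>k. ln (C_const p q) / 2 + (Binet (real k * 1) - (Binet (real k * (p / 2)) / p + Binet (real k * (q / 2)) / q)))
     \<longlonglongrightarrow> ln (C_const p q) / 2 + (L - (L / p + L / q))"
    by (intro tendsto_intros lim) (use pq(1,2) in auto)
  also have "L / p + L / q = L" using pq(3) by (metis divide_inverse distrib_left inverse_eq_divide mult.right_neutral)
  finally have "(\<lambda>k. ln (C_const p q) / 2 + (Binet k - (Binet (k * p / 2) / p + Binet (k * q / 2) / q)))
     \<longlonglongrightarrow> ln (C_const p q) / 2" by simp
  hence "(\<lambda>k. ln (Gamma_ratio p q k)) \<longlonglongrightarrow> ln (C_const p q) / 2"
    by (rule Lim_transform_eventually)
       (use eventually_gt_at_top[of "0::nat"] in eventually_elim, simp add: ln_Gamma_ratio[OF pq])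
  hence "(\<lambda>k. exp (ln (Gamma_ratio p q k))) \<longlonglongrightarrow> exp (ln (C_const p q) / 2)"
    by (rule tendsto_exp)
  thus ?thesis using Gamma_ratio_pos[of p q] C_const_pos[of p q] pq(1,2)
    by (simp add: powr_def)
qed

section \<open>Lebesgue measure and Gaussian moments\<close>

text \<open>The image measure is translation invariant, so Fubini shows that it is proportional to Lebesgue
  measure; the two agree on balls.\<close>

lemma lborel_distr_linear_isometry:
  fixes f g :: "'a::euclidean_space \<Rightarrow> 'a"
  assumes lin: "linear f" and iso: "\<And>x. norm (f x) = norm x"
    and inv: "\<And>x. f (g x) = x"
  shows "distr lborel borel f = lborel"
proof -
  define N where "N = distr lborel borel f"
  have f_meas [measurable]: "f \<in> borel_measurable borel"
    using lin by (intro borel_measurable_continuous_onI linear_continuous_on) (simp add: linear_conv_bounded_linear)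
  have N_sets [simp, measurable_cong]: "sets N = sets borel" by (simp add: N_def)
  have N_space [simp]: "space N = UNIV" by (simp add: N_def)
  have trans: "(\<integral>\<^sup>+x. h (x + y) \<partial>N) = (\<integral>\<^sup>+x. h x \<partial>N)" if [measurable]: "h \<in> borel_measurable borel" for h :: "'a \<Rightarrow> ennreal" and y
  proof -
    \<comment> \<open>Since \<open>g y\<close> is a preimage of \<open>y\<close>, translating the
      image by \<open>y\<close> pulls back to translating \<open>lborel\<close> by
      \<open>g y\<close>.\<close>
    have "(\<integral>\<^sup>+x. h (x + y) \<partial>N) = (\<integral>\<^sup>+x. h (f (g y + x)) \<partial>lborel)"
      by (simp add: N_def nn_integral_distr linear_add[OF lin] inv add.commute)
    also have "\<dots> = (\<integral>\<^sup>+x. h (f x) \<partial>distr lborel borel ((+) (g y)))"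
      by (subst nn_integral_distr) auto
    also have "\<dots> = (\<integral>\<^sup>+x. h x \<partial>N)"
      by (simp add: lborel_distr_plus N_def nn_integral_distr)
    finally show ?thesis .
  qed
  have ball: "emeasure N (ball 0 r) = emeasure lborel (ball (0::'a) r)" for r
  proof -
    have "f -` ball 0 r = ball 0 r" by (auto simp: iso)
    thus ?thesis by (simp add: N_def emeasure_distr)
  qed
  \<comment> \<open>Needed for Fubini; balls of integer radius have finite measure because
    \<open>N\<close> agrees with Lebesgue measure on them.\<close>
  interpret N: sigma_finite_measure N
  proof
    show "\<exists>A. countable A \<and> A \<subseteq> sets N \<and> \<Union>A = space N \<and> (\<forall>a\<in>A. emeasure N a \<noteq> \<infinity>)"
    proof (intro exI[of _ "range (\<lambda>n::nat. ball 0 (real n))"] conjI ballI)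
      show "\<Union> (range (\<lambda>n::nat. ball (0::'a) (real n))) = space N"
        by (auto simp: reals_Archimedean2)
    next
      fix a assume "a \<in> range (\<lambda>n::nat. ball (0::'a) (real n))"
      then obtain n where "a = ball 0 (real n)" by auto
      thus "emeasure N a \<noteq> \<infinity>"
        using emeasure_lborel_ball_finite[of "0::'a" "real n"] by (simp add: ball)
    qed auto
  qed
  interpret P: pair_sigma_finite N lborel ..
  \<comment> \<open>Both sides evaluate the double integral of
    \<open>indicator A x * indicator B (x + y)\<close>. Integrating over \<open>y\<close> first
    gives the left side; shifting \<open>x\<close> by \<open>y\<close> inside the
    \<open>N\<close>-integral and then integrating over \<open>y\<close> gives the right side, as
    \<open>lborel\<close> is invariant under reflection.\<close>
  have key: "emeasure N A * emeasure lborel B = emeasure N B * emeasure lborel A"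
    if [measurable]: "A \<in> sets borel" "B \<in> sets borel" for A B :: "'a set"
  proof -
    have "emeasure N A * emeasure lborel B = (\<integral>\<^sup>+x. indicator A x * emeasure lborel B \<partial>N)"
      by (simp add: nn_integral_multc)
    also have "\<dots> = (\<integral>\<^sup>+x. \<integral>\<^sup>+y. indicator A x * indicator B (x + y) \<partial>lborel \<partial>N)"
    proof (rule nn_integral_cong)
      fix x
      have "(\<integral>\<^sup>+y. indicator B (x + y) \<partial>lborel) = (\<integral>\<^sup>+y. indicator B y \<partial>distr lborel borel ((+) x))"
        by (subst nn_integral_distr) auto
      also have "\<dots> = emeasure lborel B" by (simp add: lborel_distr_plus)
      finally show "indicator A x * emeasure lborel B = (\<integral>\<^sup>+y. indicator A x * indicator B (x + y) \<partial>lborel)"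
        by (simp add: nn_integral_cmult)
    qed
    also have "\<dots> = (\<integral>\<^sup>+y. \<integral>\<^sup>+x. indicator A x * indicator B (x + y) \<partial>N \<partial>lborel)"
      by (rule P.Fubini'[symmetric]) measurable
    also have "\<dots> = (\<integral>\<^sup>+y. \<integral>\<^sup>+x. indicator A (x - y) * indicator B x \<partial>N \<partial>lborel)"
    proof (rule nn_integral_cong)
      fix y
      show "(\<integral>\<^sup>+x. indicator A x * indicator B (x + y) \<partial>N) = (\<integral>\<^sup>+x. indicator A (x - y) * indicator B x \<partial>N)"
        using trans[of "\<lambda>x. indicator A (x - y) * indicator B x" y] by simp
    qed
    also have "\<dots> = (\<integral>\<^sup>+x. \<integral>\<^sup>+y. indicator A (x - y) * indicator B x \<partial>lborel \<partial>N)"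
      by (rule P.Fubini') measurable
    also have "\<dots> = (\<integral>\<^sup>+x. emeasure lborel A * indicator B x \<partial>N)"
    proof (rule nn_integral_cong)
      fix x
      have "(\<integral>\<^sup>+y. indicator A (x - y) \<partial>lborel) = (\<integral>\<^sup>+y. indicator A y \<partial>distr lborel borel (\<lambda>y. x + (-1) *\<^sub>R y))"
        by (subst nn_integral_distr) auto
      also have "distr lborel borel (\<lambda>y. x + (-1) *\<^sub>R y) = (lborel :: 'a measure)"
        using lborel_affine[of "-1" x] by (simp add: density_1)
      also have "(\<integral>\<^sup>+y. indicator A y \<partial>lborel) = emeasure lborel A" using that by simp
      finally show "(\<integral>\<^sup>+y. indicator A (x - y) * indicator B x \<partial>lborel) = emeasure lborel A * indicator B x"
        by (simp add: nn_integral_multc)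
    qed
    also have "\<dots> = emeasure N B * emeasure lborel A"
      by (subst nn_integral_cmult) (auto simp: mult.commute)
    finally show ?thesis .
  qed
  have "N = lborel"
  proof (rule measure_eqI)
    fix A assume "A \<in> sets N"
    hence A: "A \<in> sets borel" by simp
    have fin: "emeasure lborel (ball (0::'a) 1) \<noteq> \<infinity>"
      using emeasure_lborel_ball_finite[of "0::'a" 1] by simp
    have pos: "emeasure lborel (ball (0::'a) 1) \<noteq> 0"
      by (simp add: emeasure_ball unit_ball_vol_pos less_imp_neq[symmetric] ennreal_eq_0_iff not_le)
    \<comment> \<open>Choose the unit ball for \<open>B\<close> in \<open>key\<close> and cancel its
      volume, which is finite and nonzero.\<close>
    show "emeasure N A = emeasure lborel A"
      using key[OF A, of "ball 0 1"] fin pos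
      by (simp add: ball mult.commute[of "emeasure N A"] ennreal_mult_cancel_left)
  qed auto
  thus ?thesis by (simp add: N_def)
qed

lemma measurable_vec_lambda [measurable]:
  fixes f :: "'b \<Rightarrow> 'n::finite \<Rightarrow> 'a::euclidean_space"
  assumes [measurable]: "\<And>i. (\<lambda>x. f x i) \<in> borel_measurable M"
  shows "(\<lambda>x. \<chi> i. f x i) \<in> borel_measurable M"
  unfolding borel_measurable_euclidean_space[of "\<lambda>x. \<chi> i. f x i"]
  by (auto simp: Basis_vec_def inner_axis)

lemma measurable_vec_nth [measurable]: "(\<lambda>z::'a::euclidean_space^'n::finite. z $ i) \<in> borel_measurable borel"
  by (intro borel_measurable_continuous_onI continuous_intros)

text \<open>Lebesgue measure is determined by the volumes of boxes, and a box of vectors is the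
  product of its coordinate boxes.\<close>

lemma lborel_vec:
  "distr (\<Pi>\<^sub>M i\<in>(UNIV::'n::finite set). lborel) borel (\<lambda>f. \<chi> i. f i) = (lborel :: ('a::euclidean_space^'n) measure)"
proof (rule lborel_eqI[symmetric])
  interpret product_sigma_finite "\<lambda>i::'n. lborel :: 'a measure" ..
  fix l u :: "'a^'n"
  assume le: "\<And>b. b \<in> Basis \<Longrightarrow> l \<bullet> b \<le> u \<bullet> b"
  have le': "(l $ i) \<bullet> b \<le> (u $ i) \<bullet> b" if "b \<in> Basis" for i b
    using le[of "axis i b"] that by (simp add: axis_in_Basis_iff inner_axis)
  have "(\<lambda>f. \<chi> i. f i) -` box l u \<inter> space (\<Pi>\<^sub>M i\<in>(UNIV::'n set). lborel) = (\<Pi>\<^sub>E i\<in>UNIV. box (l $ i) (u $ i))"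
    by (auto simp: mem_box space_PiM Basis_vec_def inner_axis PiE_def Pi_def)
  hence "emeasure (distr (\<Pi>\<^sub>M i\<in>(UNIV::'n set). lborel) borel (\<lambda>f. \<chi> i. f i)) (box l u)
     = (\<Prod>i\<in>UNIV. emeasure lborel (box (l $ i) (u $ i)))"
    by (simp add: emeasure_distr emeasure_PiM)
  also have "\<dots> = ennreal (\<Prod>i\<in>UNIV. \<Prod>b\<in>Basis. (u $ i - l $ i) \<bullet> b)"
    using le' by (simp add: emeasure_lborel_box prod_ennreal prod_nonneg inner_diff_left)
  also have "(\<Prod>i\<in>UNIV. \<Prod>b\<in>Basis. (u $ i - l $ i) \<bullet> b) = (\<Prod>b\<in>Basis. (u - l) \<bullet> b)"
  proof -
    \<comment> \<open>The basis vectors are exactly the \<open>axis i b\<close>, each arising from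
      one pair \<open>(i, b)\<close>.\<close>
    have "(\<Prod>b\<in>Basis. (u - l) \<bullet> b) = (\<Prod>(i, b)\<in>UNIV \<times> Basis. (u - l) \<bullet> axis i b)"
      by (subst prod.reindex_bij_betw[symmetric, where h = "\<lambda>(i, b). axis i b" and S = "UNIV \<times> Basis"])
         (force simp: bij_betw_def inj_on_def axis_eq_axis Basis_vec_def nonzero_Basis split_beta' image_iff)+
    thus ?thesis by (simp add: prod.cartesian_product inner_axis)
  qed
  finally show "emeasure (distr (\<Pi>\<^sub>M i\<in>(UNIV::'n set). lborel) borel (\<lambda>f. \<chi> i. f i)) (box l u)
     = (\<Prod>b\<in>Basis. (u - l) \<bullet> b)" .
qed simp

lemma nn_integral_lborel_vec_prod:
  fixes f :: "'n::finite \<Rightarrow> 'a::euclidean_space \<Rightarrow> ennreal"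
  assumes [measurable]: "\<And>i. f i \<in> borel_measurable borel"
  shows "(\<integral>\<^sup>+z. (\<Prod>i\<in>UNIV. f i (z $ i)) \<partial>lborel) = (\<Prod>i\<in>UNIV. \<integral>\<^sup>+x. f i x \<partial>lborel)"
proof -
  interpret product_sigma_finite "\<lambda>i::'n. lborel :: 'a measure" ..
  have "(\<integral>\<^sup>+z. (\<Prod>i\<in>UNIV. f i (z $ i)) \<partial>lborel)
      = (\<integral>\<^sup>+z. (\<Prod>i\<in>UNIV. f i (z $ i)) \<partial>distr (\<Pi>\<^sub>M i\<in>(UNIV::'n set). lborel) borel (\<lambda>f. \<chi> i. f i))"
    by (simp only: lborel_vec)
  also have "\<dots> = (\<integral>\<^sup>+x. (\<Prod>i\<in>UNIV. f i (x i)) \<partial>(\<Pi>\<^sub>M i\<in>(UNIV::'n set). lborel))"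
    by (subst nn_integral_distr) auto
  also have "\<dots> = (\<Prod>i\<in>UNIV. \<integral>\<^sup>+x. f i x \<partial>lborel)"
    by (rule product_nn_integral_prod) auto
  finally show ?thesis .
qed

text \<open>Replaces polar coordinates: the disc \<open>|z|^2 \<le> r\<close> has area
  \<open>pi * r\<close>, which is linear in \<open>r\<close>. Agreement on half-lines suffices, as
  they form an intersection-stable generator.\<close>

lemma distr_lborel_norm_square:
  "distr (lborel :: complex measure) borel (\<lambda>z. (norm z)\<^sup>2)
    = density lborel (\<lambda>t. ennreal pi * indicator {0..} t)" (is "?M = ?N")
proof (rule measure_eqI_generator_eq[where E = "range atMost" and \<Omega> = UNIV and A = "\<lambda>n::nat. {..real n}"])
  show "Int_stable (range (atMost :: real \<Rightarrow> _))"
    by (auto simp: Int_stable_def)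
  have M: "emeasure ?M {..r} = ennreal (pi * max 0 r)" for r :: real
  proof (cases "r < 0")
    case True
    hence "(\<lambda>z::complex. (norm z)\<^sup>2) -` {..r} = {}"
      by (auto simp: not_le) (smt (verit) zero_le_power2)
    thus ?thesis using True by (simp add: emeasure_distr)
  next
    case False
    hence "(\<lambda>z::complex. (norm z)\<^sup>2) -` {..r} = cball 0 (sqrt r)"
      by (auto simp: real_le_rsqrt real_sqrt_le_iff dest: sqrt_le_D) (smt (verit) norm_ge_zero real_le_rsqrt real_sqrt_pow2 power_mono)
    thus ?thesis using False
      by (simp add: emeasure_distr emeasure_cball unit_ball_vol_2 DIM_complex ennreal_mult'')
  qed
  have N: "emeasure ?N {..r} = ennreal (pi * max 0 r)" for r :: real
  proof -
    have "emeasure ?N {..r} = (\<integral>\<^sup>+t. ennreal pi * indicator {0..r} t \<partial>lborel)"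
      by (subst emeasure_density) (auto intro!: nn_integral_cong simp: indicator_def)
    also have "\<dots> = ennreal pi * emeasure lborel {0..r}" by (simp add: nn_integral_cmult)
    also have "\<dots> = ennreal (pi * max 0 r)"
      by (cases "0 \<le> r") (auto simp: ennreal_mult'' max_def)
    finally show ?thesis .
  qed
  show "emeasure ?M X = emeasure ?N X" if "X \<in> range atMost" for X
    using that M N by auto
  show "sets ?M = sigma_sets UNIV (range atMost)" "sets ?N = sigma_sets UNIV (range atMost)"
    by (simp_all add: borel_eq_atMost sets_measure_of_conv)
  show "(\<Union>n. {..real n}) = UNIV"
    by (auto simp: real_arch_simple)
  show "emeasure ?M {..real i} \<noteq> \<infinity>" for i by (simp add: M)
qed auto

lemma nn_integral_complex_radial:
  fixes F :: "real \<Rightarrow> ennreal"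
  assumes [measurable]: "F \<in> borel_measurable borel"
  shows "(\<integral>\<^sup>+z. F ((norm z)\<^sup>2) \<partial>(lborel :: complex measure)) = ennreal pi * (\<integral>\<^sup>+t. F t * indicator {0..} t \<partial>lborel)"
proof -
  have "(\<integral>\<^sup>+z. F ((norm z)\<^sup>2) \<partial>(lborel :: complex measure)) = (\<integral>\<^sup>+t. F t \<partial>distr (lborel :: complex measure) borel (\<lambda>z. (norm z)\<^sup>2))"
    by (simp add: nn_integral_distr)
  also have "\<dots> = (\<integral>\<^sup>+t. (ennreal pi * indicator {0..} t) * F t \<partial>lborel)"
    by (subst distr_lborel_norm_square) (simp add: nn_integral_density)
  also have "\<dots> = ennreal pi * (\<integral>\<^sup>+t. F t * indicator {0..} t \<partial>lborel)"
    by (subst nn_integral_cmult[symmetric]) (auto simp: mult_ac)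
  finally show ?thesis .
qed

section \<open>Moments of Gaussian measures\<close>

lemma nn_integral_Gamma_scaled:
  fixes a b :: real
  assumes "a > 0" "b \<ge> 0"
  shows "(\<integral>\<^sup>+t. ennreal (t powr b * exp (- a * t)) * indicator {0..} t \<partial>lborel)
          = ennreal (Gamma (b + 1) / a powr (b + 1))"
proof -
  have "((\<lambda>t. t powr b * exp (- t)) has_integral Gamma (b + 1)) {0..}"
    using Gamma_integral_real[of "b + 1"] assms by (simp add: exp_minus field_simps)
  hence G: "(\<integral>\<^sup>+t. ennreal (indicator {0..} t * (t powr b * exp (- t))) \<partial>lborel) = ennreal (Gamma (b + 1))"
    using assms by (intro nn_integral_has_integral_lebesgue) (auto)
  have "(\<integral>\<^sup>+t. ennreal (t powr b * exp (- a * t)) * indicator {0..} t \<partial>lborel)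
     = ennreal (1 / a) * (\<integral>\<^sup>+t. ennreal (((t / a) powr b * exp (- t))) * indicator {0..} (t / a) \<partial>lborel)"
    using assms by (subst nn_integral_real_affine[where c = "1/a" and t = 0]) auto
  also have "\<dots> = ennreal (1 / a) * (\<integral>\<^sup>+t. ennreal (1 / a powr b) * ennreal (indicator {0..} t * (t powr b * exp (- t))) \<partial>lborel)"
  proof (intro arg_cong[where f = "\<lambda>x. ennreal (1 / a) * x"] nn_integral_cong)
    fix t
    have "(t / a) powr b = 1 / a powr b * t powr b" if "t \<ge> 0"
      using assms that by (simp add: powr_divide)
    thus "ennreal ((t / a) powr b * exp (- t)) * indicator {0..} (t / a)
       = ennreal (1 / a powr b) * ennreal (indicator {0..} t * (t powr b * exp (- t)))"
      using assms by (cases "t \<ge> 0") (simp_all add: ennreal_mult[symmetric] zero_le_divide_iff)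
  qed
  also have "\<dots> = ennreal (1 / a) * (ennreal (1 / a powr b) * ennreal (Gamma (b + 1)))"
    by (subst nn_integral_cmult) (auto simp: G)
  also have "\<dots> = ennreal (Gamma (b + 1) / a powr (b + 1))"
    using assms by (simp add: ennreal_mult[symmetric] powr_add Gamma_real_pos less_imp_le)
  finally show ?thesis .
qed

lemma nn_integral_complex_power_gaussian:
  fixes a p :: real and k :: nat
  assumes "a > 0" "p \<ge> 0"
  shows "(\<integral>\<^sup>+z. ennreal ((norm z ^ k) powr p * exp (- a * (norm z)\<^sup>2)) \<partial>(lborel :: complex measure))
          = ennreal (pi * Gamma (k * p / 2 + 1) / a powr (k * p / 2 + 1))"
proof -
  have "(\<integral>\<^sup>+z. ennreal ((norm z ^ k) powr p * exp (- a * (norm z)\<^sup>2)) \<partial>(lborel :: complex measure))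
    = (\<integral>\<^sup>+z. ennreal ((sqrt ((norm z)\<^sup>2) ^ k) powr p * exp (- a * (norm z)\<^sup>2)) \<partial>(lborel :: complex measure))"
    by simp
  also have "\<dots> = ennreal pi * (\<integral>\<^sup>+t. ennreal ((sqrt t ^ k) powr p * exp (- a * t)) * indicator {0..} t \<partial>lborel)"
    by (rule nn_integral_complex_radial) measurable
  also have "(\<integral>\<^sup>+t. ennreal ((sqrt t ^ k) powr p * exp (- a * t)) * indicator {0..} t \<partial>lborel)
     = (\<integral>\<^sup>+t. ennreal (t powr (k * p / 2) * exp (- a * t)) * indicator {0..} t \<partial>lborel)"
  proof (rule nn_integral_cong_AE)
    \<comment> \<open>The point 0 has to be left out: for \<open>k = 0\<close> the two integrands
      differ there, because \<open>0 powr 0 = 0\<close>.\<close>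
    have "AE t in lborel. t \<noteq> (0::real)" by (rule AE_lborel_singleton)
    thus "AE t in lborel. ennreal ((sqrt t ^ k) powr p * exp (- a * t)) * indicator {0..} t
       = ennreal (t powr (k * p / 2) * exp (- a * t)) * indicator {0..} t"
    proof eventually_elim
      case (elim t)
      show ?case
      proof (cases "t > 0")
        case True
        hence "(sqrt t ^ k) powr p = t powr (k * p / 2)"
          by (simp add: powr_half_sqrt[symmetric] powr_realpow[symmetric] powr_powr mult_ac)
        thus ?thesis by simp
      qed (use elim in \<open>auto simp: indicator_def\<close>)
    qed
  qed
  also have "\<dots> = ennreal (Gamma (k * p / 2 + 1) / a powr (k * p / 2 + 1))"
    using assms by (intro nn_integral_Gamma_scaled) auto
  finally show ?thesis
    by (simp add: ennreal_mult'[symmetric])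
qed

definition monom_fn :: "('n::finite \<Rightarrow> nat) \<Rightarrow> complex^'n \<Rightarrow> complex" where
  "monom_fn j z = (\<Prod>i\<in>UNIV. (z $ i) ^ j i)"

lemma gauss_weight_eq_prod:
  fixes z :: "complex^'n::finite"
  shows "(a / pi) ^ CARD('n) * exp (- a * (norm z)\<^sup>2) = (\<Prod>i\<in>UNIV. a / pi * exp (- a * (norm (z $ i))\<^sup>2))"
proof -
  have "(norm z)\<^sup>2 = (\<Sum>i\<in>UNIV. (norm (z $ i))\<^sup>2)"
    by (simp add: norm_vec_def L2_set_def sum_nonneg)
  thus ?thesis by (simp only: prod.distrib prod_constant exp_sum[symmetric] sum_distrib_left finite)
qed

lemma norm_monom_fn: "norm (monom_fn j z) = (\<Prod>i\<in>UNIV. norm (z $ i) ^ j i)"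
  by (simp add: monom_fn_def prod_norm[symmetric] norm_power)

lemma measurable_monom_fn [measurable]: "monom_fn j \<in> borel_measurable borel"
  unfolding monom_fn_def[abs_def] by (intro borel_measurable_continuous_onI continuous_intros)

text \<open>The modulus of the monomial and the Gaussian both factor over the coordinates, leaving a
  product of planar moments; each normalising factor \<open>a / pi\<close> absorbs \<open>pi\<close>
  and one power of \<open>a\<close>.\<close>

lemma nn_integral_gauss_monom:
  fixes j :: "'n::finite \<Rightarrow> nat" and a p :: real
  assumes "a > 0" "p \<ge> 0"
  shows "(\<integral>\<^sup>+z. ennreal (norm (monom_fn j z) powr p) \<partial>gauss_measure a)
    = ennreal (\<Prod>i\<in>UNIV. Gamma (j i * p / 2 + 1) / a powr (j i * p / 2))"
proof -
  have "(\<integral>\<^sup>+z. ennreal (norm (monom_fn j z) powr p) \<partial>gauss_measure a)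
     = (\<integral>\<^sup>+z. (\<Prod>i\<in>UNIV. ennreal (a / pi) * ennreal ((norm (z $ i) ^ j i) powr p * exp (- a * (norm (z $ i))\<^sup>2))) \<partial>(lborel :: (complex^'n) measure))"
    unfolding gauss_measure_def gauss_weight_eq_prod using assms
    by (subst nn_integral_density)
       (auto intro!: nn_integral_cong simp: prod_ennreal ennreal_mult[symmetric] prod_nonneg norm_monom_fn
          prod_powr_distrib prod.distrib[symmetric] mult_ac)
  also have "\<dots> = (\<Prod>i\<in>UNIV. \<integral>\<^sup>+z. ennreal (a / pi) * ennreal ((norm z ^ j i) powr p * exp (- a * (norm z)\<^sup>2)) \<partial>(lborel :: complex measure))"
    by (rule nn_integral_lborel_vec_prod) measurable
  also have "\<dots> = (\<Prod>i\<in>UNIV. ennreal (Gamma (j i * p / 2 + 1) / a powr (j i * p / 2)))"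
  proof (rule prod.cong[OF refl])
    fix i
    have "(\<integral>\<^sup>+z. ennreal (a / pi) * ennreal ((norm z ^ j i) powr p * exp (- a * (norm z)\<^sup>2)) \<partial>(lborel :: complex measure))
      = ennreal (a / pi) * ennreal (pi * Gamma (j i * p / 2 + 1) / a powr (j i * p / 2 + 1))"
      using assms by (subst nn_integral_cmult, measurable, subst nn_integral_complex_power_gaussian) auto
    also have "\<dots> = ennreal (Gamma (j i * p / 2 + 1) / a powr (j i * p / 2))"
      using assms by (subst ennreal_mult'[symmetric]) (simp_all add: powr_add)
    finally show "(\<integral>\<^sup>+z. ennreal (a / pi) * ennreal ((norm z ^ j i) powr p * exp (- a * (norm z)\<^sup>2)) \<partial>(lborel :: complex measure))
      = ennreal (Gamma (j i * p / 2 + 1) / a powr (j i * p / 2))" .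
  qed
  also have "\<dots> = ennreal (\<Prod>i\<in>UNIV. Gamma (j i * p / 2 + 1) / a powr (j i * p / 2))"
    using assms by (intro prod_ennreal) (auto intro!: divide_nonneg_nonneg less_imp_le[OF Gamma_real_pos] add_nonneg_pos)
  finally show ?thesis .
qed

section \<open>Torus averages\<close>

text \<open>Normalised Haar measure of the circle, with angles counted in full turns. It is a
  density on the whole line, so its measurable sets are those of \<open>borel\<close>.\<close>

definition unit_interval_measure :: "real measure" where
  "unit_interval_measure = density lborel (indicator {0..1})"

lemma sets_unit_interval_measure [simp, measurable_cong]: "sets unit_interval_measure = sets borel"
  by (simp add: unit_interval_measure_def)

lemma space_unit_interval_measure [simp]: "space unit_interval_measure = UNIV"
  by (simp add: unit_interval_measure_def)

lemma emeasure_unit_interval_measure [simp]: "emeasure unit_interval_measure UNIV = 1"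
  by (simp add: unit_interval_measure_def emeasure_density)

interpretation unit_interval: finite_measure unit_interval_measure
  by standard simp

lemma measurable_cnj [measurable]: "cnj \<in> borel_measurable borel"
  by (intro borel_measurable_continuous_onI continuous_intros)

lemma measurable_cis [measurable]: "cis \<in> borel_measurable borel"
  by (intro borel_measurable_continuous_onI continuous_intros)

lemma integral_unit_interval_measure_character:
  "(\<integral>y. cis (2 * pi * y) ^ n * cnj (cis (2 * pi * y)) ^ k \<partial>unit_interval_measure) = (if n = k then 1 else 0)"
proof -
  \<comment> \<open>A real difference, since \<open>k\<close> may exceed \<open>n\<close>.\<close>
  define m where "m = real n - real k"
  have eq: "cis (2 * pi * y) ^ n * cnj (cis (2 * pi * y)) ^ k = cis (2 * pi * m * y)" for y
    by (simp add: m_def cis_cnj Complex.DeMoivre cis_mult algebra_simps)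
  show ?thesis
  proof (cases "n = k")
    case True
    hence "cis (2 * pi * y) ^ n * cnj (cis (2 * pi * y)) ^ k = 1" for y
      unfolding eq by (simp add: m_def True)
    thus ?thesis using True by (simp add: measure_def)
  next
    case False
    hence m: "m \<noteq> 0" by (simp add: m_def)
    \<comment> \<open>An antiderivative of the character; \<open>m\<close> is a nonzero integer, so
      the values at 0 and 1 coincide.\<close>
    define F where "F y = cis (2 * pi * m * y) / (2 * pi * m * \<i>)" for y
    have "has_bochner_integral lborel (\<lambda>y. indicator {0..1} y *\<^sub>R cis (2 * pi * m * y)) (F 1 - F 0)"
    proof (rule has_bochner_integral_FTC_Icc)
      show "(F has_vector_derivative cis (2 * pi * m * x)) (at x within {0..1})" for x
        unfolding F_def cis_conv_exp using m
        by (auto intro!: derivative_eq_intros has_vector_derivative_real_field simp: field_simps)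
      show "continuous_on {0..1} (\<lambda>x. cis (2 * pi * m * x))"
        by (intro continuous_intros)
    qed simp
    moreover have "F 1 - F 0 = 0"
    proof -
      have "cis (2 * pi * m) = 1" unfolding m_def
        by (rule cis_multiple_2pi) (auto)
      thus ?thesis by (simp add: F_def)
    qed
    ultimately have "(\<integral>y. indicator {0..1} y *\<^sub>R cis (2 * pi * m * y) \<partial>lborel) = 0"
      by (simp add: has_bochner_integral_iff)
    moreover have M: "unit_interval_measure = density lborel (\<lambda>y. ennreal (indicator {0..1} y))"
      by (simp add: unit_interval_measure_def ennreal_indicator)
    ultimately show ?thesis using False
      unfolding M eq by (subst integral_density) auto
  qed
qed

text \<open>Integrating the Taylor series at 0 term by term, orthogonality of the characters leaves
  only the \<open>k\<close>-th term.\<close>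

lemma entire_fourier_coeff:
  assumes f: "f holomorphic_on UNIV"
  shows "(\<integral>y. f (cis (2 * pi * y) * t) * cnj (cis (2 * pi * y)) ^ k \<partial>unit_interval_measure)
       = (deriv ^^ k) f 0 / fact k * t ^ k"
proof -
  define a where "a n = (deriv ^^ n) f 0 / fact n" for n
  define G where "G n y = a n * t ^ n * (cis (2 * pi * y) ^ n * cnj (cis (2 * pi * y)) ^ k)" for n y
  have sums: "(\<lambda>n. a n * w ^ n) sums f w" for w
    using holomorphic_power_series[of f 0 "norm w + 1" w] f
    by (auto simp: a_def intro: holomorphic_on_subset)
  \<comment> \<open>Convergence at a point of larger modulus gives absolute convergence at
    \<open>t\<close>; this majorant serves all angles at once.\<close>
  have summ: "summable (\<lambda>n. norm (a n * t ^ n))"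
    by (rule powser_insidea[OF sums_summable[OF sums[of "of_real (norm t + 1)"]]])
       (unfold norm_of_real, simp)
  have normG: "norm (G n y) = norm (a n * t ^ n)" for n y
    by (simp add: G_def norm_mult norm_power)
  have G_meas [measurable]: "G n \<in> borel_measurable borel" for n
    unfolding G_def by measurable
  have G_int: "integrable unit_interval_measure (G n)" for n
    by (rule unit_interval.integrable_const_bound[of _ "norm (a n * t ^ n)"]) (auto simp: normG)
  have "(\<lambda>n. integral\<^sup>L unit_interval_measure (G n)) sums (\<integral>y. (\<Sum>n. G n y) \<partial>unit_interval_measure)"
  proof (rule sums_integral)
    show "AE y in unit_interval_measure. summable (\<lambda>n. norm (G n y))"
      using summ by (simp add: normG)
    show "summable (\<lambda>n. \<integral>y. norm (G n y) \<partial>unit_interval_measure)"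
      using summ by (simp add: normG measure_def)
  qed (rule G_int)
  moreover have "(\<Sum>n. G n y) = f (cis (2 * pi * y) * t) * cnj (cis (2 * pi * y)) ^ k" for y
  proof -
    have "(\<lambda>n. a n * (cis (2 * pi * y) * t) ^ n * cnj (cis (2 * pi * y)) ^ k) sums
        (f (cis (2 * pi * y) * t) * cnj (cis (2 * pi * y)) ^ k)"
      by (intro sums_mult2 sums)
    thus ?thesis by (simp add: sums_iff G_def power_mult_distrib mult_ac)
  qed
  moreover have "integral\<^sup>L unit_interval_measure (G n) = (if n = k then a k * t ^ k else 0)" for n
    unfolding G_def by (simp add: integral_unit_interval_measure_character)
  ultimately have "(\<lambda>n. if n = k then a k * t ^ k else 0) sums
      (\<integral>y. f (cis (2 * pi * y) * t) * cnj (cis (2 * pi * y)) ^ k \<partial>unit_interval_measure)"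
    by simp
  moreover have "(\<lambda>n. if n = k then a k * t ^ k else 0) sums (a k * t ^ k)"
    using sums_single[of k "\<lambda>n. a k * t ^ k"] by simp
  ultimately show ?thesis by (simp add: sums_iff a_def)
qed

definition torus_measure :: "('n::finite \<Rightarrow> real) measure" where
  "torus_measure = (\<Pi>\<^sub>M i\<in>UNIV. unit_interval_measure)"

definition rot :: "('n::finite \<Rightarrow> real) \<Rightarrow> complex^'n \<Rightarrow> complex^'n" where
  "rot \<theta> z = (\<chi> i. cis (2 * pi * \<theta> i) * z $ i)"

text \<open>\<open>rot \<theta> 1\<close> rotates the all-ones vector, so
  \<open>monom_fn j (rot \<theta> 1)\<close> is the torus character of frequency \<open>j\<close>,
  and this is the \<open>j\<close>-th Fourier coefficient of \<open>g\<close> along the torus orbit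
  of \<open>z\<close>.\<close>

definition torus_coeff :: "('n::finite \<Rightarrow> nat) \<Rightarrow> (complex^'n \<Rightarrow> complex) \<Rightarrow> complex^'n \<Rightarrow> complex" where
  "torus_coeff j g z = (\<integral>\<theta>. g (rot \<theta> z) * cnj (monom_fn j (rot \<theta> 1)) \<partial>torus_measure)"

definition vec_upd :: "'a^'n::finite \<Rightarrow> 'n \<Rightarrow> 'a \<Rightarrow> 'a^'n" where
  "vec_upd z i t = (\<chi> l. if l = i then t else z $ l)"

interpretation torus_prod: product_sigma_finite "\<lambda>i::'n::finite. unit_interval_measure"
  by standard

lemma space_torus_measure [simp]: "space torus_measure = UNIV"
  by (simp add: torus_measure_def space_PiM)

lemma emeasure_torus_measure [simp]: "emeasure torus_measure UNIV = 1"
proof -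
  have "emeasure torus_measure (\<Pi>\<^sub>E i\<in>UNIV. UNIV) = 1"
    unfolding torus_measure_def by (subst torus_prod.emeasure_PiM) auto
  thus ?thesis by simp
qed

interpretation torus: finite_measure torus_measure
  by standard simp

lemma measurable_torus_component [measurable]: "(\<lambda>\<theta>. \<theta> i) \<in> borel_measurable torus_measure"
  unfolding torus_measure_def using measurable_component_singleton[of i UNIV "\<lambda>_. unit_interval_measure"]
  by (simp cong: measurable_cong_sets)

lemma norm_rot [simp]: "norm (rot \<theta> z) = norm z"
  by (simp add: rot_def norm_vec_def norm_mult)

lemma monom_fn_rot: "monom_fn j (rot \<theta> z) = monom_fn j (rot \<theta> 1) * monom_fn j z"
  by (simp add: monom_fn_def rot_def power_mult_distrib prod.distrib)

lemma norm_monom_fn_rot [simp]: "norm (monom_fn j (rot \<theta> z)) = norm (monom_fn j z)"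
  by (simp add: norm_monom_fn rot_def norm_mult)

lemma measurable_rot [measurable]:
  assumes [measurable]: "f \<in> M \<rightarrow>\<^sub>M torus_measure" "g \<in> borel_measurable M"
  shows "(\<lambda>x. rot (f x) (g x)) \<in> borel_measurable M"
  unfolding rot_def by measurable

lemma distr_lborel_rot: "distr lborel borel (rot \<theta>) = (lborel :: (complex^'n::finite) measure)"
proof (rule lborel_distr_linear_isometry)
  show "linear (rot \<theta>)"
    by (rule linearI) (simp_all add: rot_def vec_eq_iff algebra_simps)
  show "rot \<theta> (rot (\<lambda>i. - \<theta> i) z) = z" for z :: "complex^'n"
    by (simp add: rot_def vec_eq_iff cis_mult flip: mult.assoc)
qed simp

text \<open>Rotations keep \<open>z\<close> inside a compact ball, where the continuous
  \<open>g\<close> is bounded, and the character has modulus 1.\<close>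

lemma torus_coeff_integrable:
  assumes g: "continuous_on UNIV g"
  shows "integrable torus_measure (\<lambda>\<theta>. g (rot \<theta> z) * cnj (monom_fn j (rot \<theta> 1)))"
proof -
  have [measurable]: "g \<in> borel_measurable borel" using g by (rule borel_measurable_continuous_onI)
  have "compact (g ` cball 0 (norm z))"
    by (intro compact_continuous_image continuous_on_subset[OF g]) auto
  then obtain B where B: "\<And>w. norm w \<le> norm z \<Longrightarrow> norm (g w) \<le> B"
    by (fastforce dest!: compact_imp_bounded simp: bounded_iff)
  show ?thesis
  proof (rule torus.integrable_const_bound[of _ B])
    show "AE \<theta> in torus_measure. norm (g (rot \<theta> z) * cnj (monom_fn j (rot \<theta> 1))) \<le> B"
      using B by (simp add: norm_mult) (simp add: norm_monom_fn)
  qed measurable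
qed

text \<open>Fubini isolates the angle of coordinate \<open>i\<close>. The inner integral is a
  Fourier coefficient of an entire function of one variable, hence a constant times
  \<open>t ^ j i\<close>.\<close>

lemma torus_coeff_upd:
  fixes g :: "complex^'n::finite \<Rightarrow> complex"
  assumes cont: "continuous_on UNIV g"
    and hol: "\<And>z i. (\<lambda>t. g (vec_upd z i t)) holomorphic_on UNIV"
  shows "torus_coeff j g (vec_upd z i t) = t ^ j i * torus_coeff j g (vec_upd z i 1)"
proof -
  \<comment> \<open>\<open>K\<close> collects the characters of the other angles and
    \<open>D\<close> is the Taylor coefficient of the slice. Both depend only on the angles other
    than \<open>i\<close>, as \<open>vec_upd\<close> overwrites coordinate \<open>i\<close>.\<close>
  define K where "K \<theta> = (\<Prod>l\<in>UNIV - {i}. cnj (cis (2 * pi * \<theta> l)) ^ j l)" for \<theta> :: "'n \<Rightarrow> real"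
  define D where "D \<theta> = (deriv ^^ j i) (\<lambda>t. g (vec_upd (rot \<theta> z) i t)) 0 / fact (j i)" for \<theta>
  have "torus_coeff j g (vec_upd z i t) = t ^ j i * (\<integral>\<theta>. K \<theta> * D \<theta> \<partial>(\<Pi>\<^sub>M l\<in>UNIV - {i}. unit_interval_measure))" for t
  proof -
    have "torus_coeff j g (vec_upd z i t) = (\<integral>\<theta>. g (rot \<theta> (vec_upd z i t)) * cnj (monom_fn j (rot \<theta> 1)) \<partial>(\<Pi>\<^sub>M l\<in>insert i (UNIV - {i}). unit_interval_measure))"
      by (simp add: torus_coeff_def torus_measure_def insert_UNIV)
    also have "\<dots> = (\<integral>\<theta>. (\<integral>y. g (rot (\<theta>(i := y)) (vec_upd z i t)) * cnj (monom_fn j (rot (\<theta>(i := y)) 1)) \<partial>unit_interval_measure)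
         \<partial>(\<Pi>\<^sub>M l\<in>UNIV - {i}. unit_interval_measure))"
    proof (rule torus_prod.product_integral_insert)
      show "integrable (Pi\<^sub>M (insert i (UNIV - {i})) (\<lambda>l. unit_interval_measure))
         (\<lambda>\<theta>. g (rot \<theta> (vec_upd z i t)) * cnj (monom_fn j (rot \<theta> 1)))"
        using torus_coeff_integrable[OF cont, of "vec_upd z i t" j] by (simp add: torus_measure_def insert_UNIV)
    qed auto
    also have "\<dots> = (\<integral>\<theta>. t ^ j i * (K \<theta> * D \<theta>) \<partial>(\<Pi>\<^sub>M l\<in>UNIV - {i}. unit_interval_measure))"
    proof (rule Bochner_Integration.integral_cong[OF refl])
      fix \<theta> :: "'n \<Rightarrow> real"
      have 1: "rot (\<theta>(i := y)) (vec_upd z i t) = vec_upd (rot \<theta> z) i (cis (2 * pi * y) * t)" for y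
        by (simp add: rot_def vec_upd_def vec_eq_iff)
      have 2: "cnj (monom_fn j (rot (\<theta>(i := y)) 1)) = K \<theta> * cnj (cis (2 * pi * y)) ^ j i" for y
        unfolding monom_fn_def rot_def K_def by (subst prod.remove[of UNIV i]) (auto simp: mult.commute)
      have "(\<integral>y. g (rot (\<theta>(i := y)) (vec_upd z i t)) * cnj (monom_fn j (rot (\<theta>(i := y)) 1)) \<partial>unit_interval_measure)
         = (\<integral>y. K \<theta> * (g (vec_upd (rot \<theta> z) i (cis (2 * pi * y) * t)) * cnj (cis (2 * pi * y)) ^ j i) \<partial>unit_interval_measure)"
        unfolding 1 2 by (simp add: mult_ac)
      also have "\<dots> = K \<theta> * (D \<theta> * t ^ j i)"
        unfolding D_def using entire_fourier_coeff[OF hol[of "rot \<theta> z" i], of t "j i"] by simp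
      finally show "(\<integral>y. g (rot (\<theta>(i := y)) (vec_upd z i t)) * cnj (monom_fn j (rot (\<theta>(i := y)) 1)) \<partial>unit_interval_measure)
         = t ^ j i * (K \<theta> * D \<theta>)" by (simp add: mult_ac)
    qed
    finally show ?thesis by simp
  qed
  \<comment> \<open>The case \<open>t = 1\<close> identifies the remaining integral.\<close>
  from this[of t] this[of 1] show ?thesis by simp
qed

text \<open>The coordinates of \<open>z\<close> are replaced by 1 one at a time, each replacement
  releasing its power \<open>(z $ i) ^ j i\<close>.\<close>

lemma torus_coeff_eq_monom:
  fixes g :: "complex^'n::finite \<Rightarrow> complex"
  assumes cont: "continuous_on UNIV g"
    and hol: "\<And>z i. (\<lambda>t. g (vec_upd z i t)) holomorphic_on UNIV"
  shows "torus_coeff j g z = monom_fn j z * torus_coeff j g 1"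
proof -
  have "torus_coeff j g z = (\<Prod>i\<in>S. (z $ i) ^ j i) * torus_coeff j g (\<chi> l. if l \<in> S then 1 else z $ l)"
    if "finite S" for S :: "'n set"
    using that
  proof (induction S rule: finite_induct)
    case empty
    show ?case by simp
  next
    case (insert i S)
    define w where "w = (\<chi> l. if l \<in> S then 1 else z $ l)"
    have "w = vec_upd w i (z $ i)" using insert.hyps by (auto simp: w_def vec_upd_def vec_eq_iff)
    moreover have "(\<chi> l. if l \<in> insert i S then 1 else z $ l) = vec_upd w i 1"
      by (auto simp: w_def vec_upd_def vec_eq_iff)
    ultimately show ?case
      using insert torus_coeff_upd[OF cont hol, of j w i "z $ i"] by (simp add: w_def)
  qed
  from this[of UNIV] show ?thesis by (simp add: monom_fn_def one_vec_def)
qed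

text \<open>Rotations preserve Lebesgue measure and \<open>W\<close>, so the integral equals its
  average over the torus. After Fubini the angular integral turns \<open>g\<close> into a constant
  times \<open>z^j\<close>, which meets its own conjugate.\<close>

lemma integral_torus_invariant_monom:
  fixes g :: "complex^'n::finite \<Rightarrow> complex" and W :: "complex^'n \<Rightarrow> real"
  assumes cont: "continuous_on UNIV g"
    and hol: "\<And>z i. (\<lambda>t. g (vec_upd z i t)) holomorphic_on UNIV"
    and W: "\<And>\<theta> z. W (rot \<theta> z) = W z"
    and int: "integrable lborel (\<lambda>z. g z * cnj (monom_fn j z) * of_real (W z))"
  shows "(\<integral>z. g z * cnj (monom_fn j z) * of_real (W z) \<partial>lborel)
       = torus_coeff j g 1 * of_real (\<integral>z. (norm (monom_fn j z))\<^sup>2 * W z \<partial>lborel)"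
proof -
  define F where "F z = g z * cnj (monom_fn j z) * of_real (W z)" for z
  have F: "integrable lborel F" using int by (simp add: F_def[abs_def])
  have F_meas [measurable]: "F \<in> borel_measurable borel"
    using borel_measurable_integrable[OF F] by simp
  have rot_meas: "rot \<theta> \<in> borel_measurable borel" for \<theta> :: "'n \<Rightarrow> real"
    unfolding rot_def[abs_def] by measurable
  interpret P: pair_sigma_finite "torus_measure :: ('n \<Rightarrow> real) measure" "lborel :: (complex^'n) measure" ..
  have eq1: "(\<integral>z. F (rot \<theta> z) \<partial>lborel) = (\<integral>z. F z \<partial>lborel)" for \<theta>
  proof -
    have "(\<integral>z. F z \<partial>distr lborel borel (rot \<theta>)) = (\<integral>z. F (rot \<theta> z) \<partial>lborel)"
      using rot_meas by (intro integral_distr) auto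
    thus ?thesis by (simp add: distr_lborel_rot)
  qed
  have eq2: "(\<integral>\<^sup>+z. norm (F (rot \<theta> z)) \<partial>lborel) = (\<integral>\<^sup>+z. norm (F z) \<partial>lborel)" for \<theta>
  proof -
    have "(\<integral>\<^sup>+z. norm (F z) \<partial>distr lborel borel (rot \<theta>)) = (\<integral>\<^sup>+z. norm (F (rot \<theta> z)) \<partial>lborel)"
      using rot_meas by (intro nn_integral_distr) auto
    thus ?thesis by (simp add: distr_lborel_rot)
  qed
  \<comment> \<open>By Tonelli the integral of the norm averages a quantity that by
    \<open>eq2\<close> is the same for every angle.\<close>
  have int2: "integrable (torus_measure \<Otimes>\<^sub>M lborel) (\<lambda>(\<theta>, z). F (rot \<theta> z))"
  proof (rule integrableI_bounded)
    have "(\<integral>\<^sup>+x. norm (case x of (\<theta>, z) \<Rightarrow> F (rot \<theta> z)) \<partial>(torus_measure \<Otimes>\<^sub>M lborel))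
        = (\<integral>\<^sup>+\<theta>. \<integral>\<^sup>+z. norm (F (rot \<theta> z)) \<partial>lborel \<partial>torus_measure)"
      by (subst lborel.nn_integral_fst[symmetric]) (auto simp: split_beta')
    also have "\<dots> = (\<integral>\<^sup>+z. norm (F z) \<partial>lborel)" by (simp add: eq2)
    also have "\<dots> < \<infinity>" using F by (simp add: integrable_iff_bounded)
    finally show "(\<integral>\<^sup>+x. norm (case x of (\<theta>, z) \<Rightarrow> F (rot \<theta> z)) \<partial>(torus_measure \<Otimes>\<^sub>M lborel)) < \<infinity>" .
  qed measurable
  have "(\<integral>z. F z \<partial>lborel) = (\<integral>\<theta>. \<integral>z. F (rot \<theta> z) \<partial>lborel \<partial>torus_measure)"
    by (simp add: eq1 measure_def)
  also have "\<dots> = (\<integral>z. \<integral>\<theta>. F (rot \<theta> z) \<partial>torus_measure \<partial>lborel)"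
    by (rule P.Fubini_integral[OF int2, symmetric])
  also have "\<dots> = (\<integral>z. torus_coeff j g 1 * of_real ((norm (monom_fn j z))\<^sup>2 * W z) \<partial>lborel)"
  proof (rule Bochner_Integration.integral_cong[OF refl])
    fix z
    have "(\<integral>\<theta>. F (rot \<theta> z) \<partial>torus_measure)
      = (\<integral>\<theta>. (cnj (monom_fn j z) * of_real (W z)) * (g (rot \<theta> z) * cnj (monom_fn j (rot \<theta> 1))) \<partial>torus_measure)"
      unfolding F_def W monom_fn_rot[of j _ z] by (simp add: mult_ac)
    also have "\<dots> = (cnj (monom_fn j z) * of_real (W z)) * torus_coeff j g z"
      unfolding torus_coeff_def by simp
    also have "\<dots> = torus_coeff j g 1 * of_real ((norm (monom_fn j z))\<^sup>2 * W z)"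
      unfolding torus_coeff_eq_monom[OF cont hol, of j z] of_real_mult complex_norm_square by (simp add: mult_ac)
    finally show "(\<integral>\<theta>. F (rot \<theta> z) \<partial>torus_measure) = torus_coeff j g 1 * of_real ((norm (monom_fn j z))\<^sup>2 * W z)" .
  qed
  also have "\<dots> = torus_coeff j g 1 * of_real (\<integral>z. (norm (monom_fn j z))\<^sup>2 * W z \<partial>lborel)"
    by (simp del: of_real_mult)
  finally show ?thesis by (simp add: F_def)
qed

section \<open>Pairings with monomials\<close>

lemma holomorphic_n_mult:
  assumes "holomorphic_n f" "holomorphic_n g"
  shows "holomorphic_n (\<lambda>z. f z * g z)"
  unfolding holomorphic_n_def
proof
  fix z
  obtain F G where F: "(f has_derivative F) (at z)" "\<And>c v. F (c *s v) = c * F v"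
    and G: "(g has_derivative G) (at z)" "\<And>c v. G (c *s v) = c * G v"
    using assms unfolding holomorphic_n_def by metis
  show "\<exists>L. ((\<lambda>z. f z * g z) has_derivative L) (at z) \<and> (\<forall>c v. L (c *s v) = c * L v)"
    using has_derivative_mult[OF F(1) G(1)] F(2) G(2)
    by (intro exI conjI) (auto simp: algebra_simps)
qed

lemma holomorphic_n_const: "holomorphic_n (\<lambda>z. c)"
  unfolding holomorphic_n_def by (auto intro!: exI[of _ "\<lambda>v. 0"])

lemma holomorphic_n_nth: "holomorphic_n (\<lambda>z. z $ i)"
  unfolding holomorphic_n_def
  by (auto intro!: exI[of _ "\<lambda>v. v $ i"] bounded_linear_imp_has_derivative bounded_linear_vec_nth)

lemma holomorphic_n_monom_fn: "holomorphic_n (monom_fn j)"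
proof -
  have pow: "holomorphic_n (\<lambda>z. z $ i ^ n)" for i :: 'a and n
    by (induction n) (auto intro: holomorphic_n_const holomorphic_n_mult holomorphic_n_nth)
  have "holomorphic_n (\<lambda>z. \<Prod>i\<in>S. z $ i ^ j i)" if "finite S" for S :: "'a set"
    using that by (induction S rule: finite_induct) (auto intro: holomorphic_n_const holomorphic_n_mult pow)
  from this[of UNIV] show ?thesis by (simp add: monom_fn_def[abs_def])
qed

lemma holomorphic_n_imp_continuous_on: "holomorphic_n f \<Longrightarrow> continuous_on UNIV f"
  unfolding holomorphic_n_def
  by (metis continuous_at_imp_continuous_on has_derivative_continuous)

text \<open>Along coordinate \<open>i\<close> the derivative is \<open>L (axis i s)\<close>; complex
  homogeneity of \<open>L\<close> makes this multiplication by \<open>L (axis i 1)\<close>, a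
  complex derivative.\<close>

lemma holomorphic_n_slice:
  assumes "holomorphic_n f"
  shows "(\<lambda>t. f (vec_upd z i t)) holomorphic_on UNIV"
proof (rule holomorphic_onI)
  fix t
  obtain L where L: "(f has_derivative L) (at (vec_upd z i t))" "\<And>c v. L (c *s v) = c * L v"
    using assms unfolding holomorphic_n_def by metis
  have axis: "axis i s = s *s axis i 1" for s :: complex
    by (simp add: vec_eq_iff axis_def)
  have "linear (axis i :: complex \<Rightarrow> _)"
    by (rule linearI) (simp_all add: vec_eq_iff axis_def)
  hence "bounded_linear (axis i :: complex \<Rightarrow> _)" by (simp add: linear_conv_bounded_linear)
  hence "((\<lambda>t. vec_upd z i 0 + axis i t) has_derivative (\<lambda>s. axis i s)) (at t)"
    by (auto intro!: derivative_eq_intros bounded_linear_imp_has_derivative)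
  moreover have "(\<lambda>t. vec_upd z i 0 + axis i t) = vec_upd z i"
    by (auto simp: fun_eq_iff vec_eq_iff axis_def vec_upd_def)
  ultimately have "(vec_upd z i has_derivative axis i) (at t)" by simp
  from diff_chain_at[OF this L(1)]
  have "((\<lambda>t. f (vec_upd z i t)) has_derivative (\<lambda>s. L (axis i s))) (at t)" by (simp add: o_def)
  moreover have "(\<lambda>s. L (axis i s)) = (*) (L (axis i 1))"
    by (subst axis) (simp add: fun_eq_iff L(2) mult.commute)
  ultimately have "((\<lambda>t. f (vec_upd z i t)) has_field_derivative L (axis i 1)) (at t)"
    by (simp add: has_field_derivative_def)
  thus "(\<lambda>t. f (vec_upd z i t)) field_differentiable at t within UNIV"
    by (auto simp: field_differentiable_def)
qed

lemma sets_gauss_measure [simp, measurable_cong]: "sets (gauss_measure a) = sets borel"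
  by (simp add: gauss_measure_def)

lemma has_bochner_integral_gauss_monom:
  fixes j :: "'n::finite \<Rightarrow> nat" and a p :: real
  assumes "a > 0" "p \<ge> 0"
  shows "has_bochner_integral (gauss_measure a) (\<lambda>z. norm (monom_fn j z) powr p)
          (\<Prod>i\<in>UNIV. Gamma (j i * p / 2 + 1) / a powr (j i * p / 2))"
  using assms
  by (intro has_bochner_integral_nn_integral nn_integral_gauss_monom)
     (auto intro!: prod_nonneg divide_nonneg_nonneg less_imp_le[OF Gamma_real_pos] add_nonneg_pos)

lemma integral_gauss_monom_square:
  assumes "a > 0"
  shows "(\<integral>z. (norm (monom_fn j z))\<^sup>2 \<partial>gauss_measure a) = (\<Prod>i\<in>UNIV. fact (j i) / a ^ j i)"
  using has_bochner_integral_gauss_monom[of a 2 j] assms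
  by (simp add: has_bochner_integral_iff Gamma_fact add.commute powr_realpow)

text \<open>The Gaussian density depends on \<open>norm z\<close> alone, so it is rotation invariant
  and can be absorbed into the weight \<open>W\<close> of the Lebesgue version.\<close>

lemma integral_gauss_torus_invariant_monom:
  fixes g :: "complex^'n::finite \<Rightarrow> complex" and V :: "complex^'n \<Rightarrow> real"
  assumes "a > 0" and g: "holomorphic_n g"
    and V: "\<And>\<theta> z. V (rot \<theta> z) = V z" and V_meas [measurable]: "V \<in> borel_measurable borel"
    and int: "integrable (gauss_measure a) (\<lambda>z. g z * cnj (monom_fn j z) * of_real (V z))"
  shows "(\<integral>z. g z * cnj (monom_fn j z) * of_real (V z) \<partial>gauss_measure a)
       = torus_coeff j g 1 * of_real (\<integral>z. (norm (monom_fn j z))\<^sup>2 * V z \<partial>gauss_measure a)"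
proof -
  define w where "w z = (a / pi) ^ CARD('n) * exp (- a * (norm z)\<^sup>2)" for z :: "complex^'n"
  have w: "w z \<ge> 0" for z using \<open>a > 0\<close> by (simp add: w_def)
  have [measurable]: "w \<in> borel_measurable borel" unfolding w_def[abs_def] by measurable
  have gauss: "gauss_measure a = density lborel w" by (simp add: gauss_measure_def w_def[abs_def])
  have cont: "continuous_on UNIV g" using g by (rule holomorphic_n_imp_continuous_on)
  hence [measurable]: "g \<in> borel_measurable borel" by (rule borel_measurable_continuous_onI)
  have eq: "g z * cnj (monom_fn j z) * of_real (V z * w z) = w z *\<^sub>R (g z * cnj (monom_fn j z) * of_real (V z))" for z
    by (simp add: scaleR_conv_of_real)
  have "integrable lborel (\<lambda>z. g z * cnj (monom_fn j z) * of_real (V z * w z))"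
    using int w unfolding gauss eq by (subst (asm) integrable_density) auto
  from integral_torus_invariant_monom[OF cont holomorphic_n_slice[OF g] _ this]
  have "(\<integral>z. g z * cnj (monom_fn j z) * of_real (V z * w z) \<partial>lborel)
       = torus_coeff j g 1 * of_real (\<integral>z. (norm (monom_fn j z))\<^sup>2 * (V z * w z) \<partial>lborel)"
    by (simp add: V w_def)
  also have "(\<integral>z. g z * cnj (monom_fn j z) * of_real (V z * w z) \<partial>lborel)
      = (\<integral>z. g z * cnj (monom_fn j z) * of_real (V z) \<partial>gauss_measure a)"
    unfolding gauss eq using w by (subst integral_density) auto
  also have "(\<integral>z. (norm (monom_fn j z))\<^sup>2 * (V z * w z) \<partial>lborel) = (\<integral>z. (norm (monom_fn j z))\<^sup>2 * V z \<partial>gauss_measure a)"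
    unfolding gauss using w by (subst integral_density) (auto simp: mult_ac)
  finally show ?thesis .
qed

text \<open>The weight 1 gives equality for an integrable product. Otherwise the Bochner integral is
  0 by convention, which the inequality allows for.\<close>

lemma norm_fock_inner_monom_le:
  assumes "\<alpha> > 0" "holomorphic_n g"
  shows "norm (fock_inner \<alpha> g (monom_fn j)) \<le> norm (torus_coeff j g 1) * (\<Prod>i\<in>UNIV. fact (j i) / \<alpha> ^ j i)"
proof (cases "integrable (gauss_measure \<alpha>) (\<lambda>z. g z * cnj (monom_fn j z))")
  case True
  have "(\<integral>z. (norm (monom_fn j z))\<^sup>2 \<partial>gauss_measure \<alpha>) = (\<Prod>i\<in>UNIV. fact (j i) / \<alpha> ^ j i)"
    using assms(1) by (rule integral_gauss_monom_square)
  thus ?thesis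
    using integral_gauss_torus_invariant_monom[of \<alpha> g "\<lambda>_. 1" j] assms True
    by (simp add: fock_inner_def norm_mult prod_nonneg del: of_real_prod)
next
  case False
  thus ?thesis using assms by (simp add: fock_inner_def not_integrable_integral_eq prod_nonneg)
qed

text \<open>Hoelder's inequality, derived from Young's, for \<open>u\<close>, that is
  \<open>g\<close> paired with \<open>h\<close> under the weight \<open>|h|^(p-2)\<close>: its
  integral is the coefficient times \<open>H\<close>, and \<open>(p - 1) * q = p\<close> turns the
  dual norm into a power of \<open>H\<close>.\<close>

lemma torus_coeff_bound:
  fixes g :: "complex^'n::finite \<Rightarrow> complex"
  assumes "\<alpha> > 0" "p > 1" "q > 1" "1 / p + 1 / q = 1" and g: "g \<in> fock_space p \<alpha>"
  shows "norm (torus_coeff j g 1) * fock_norm p \<alpha> (monom_fn j) \<le> fock_norm p \<alpha> g"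
proof -
  define \<gamma> where "\<gamma> = (gauss_measure (\<alpha> * p / 2) :: (complex^'n) measure)"
  define h where "h = (monom_fn j :: complex^'n \<Rightarrow> complex)"
  define G where "G = (\<integral>z. norm (g z) powr p \<partial>\<gamma>)"
  define H where "H = (\<integral>z. norm (h z) powr p \<partial>\<gamma>)"
  define c where "c = norm (torus_coeff j g 1)"
  have hol: "holomorphic_n g" using g by (simp add: fock_space_def)
  have a: "\<alpha> * p / 2 > 0" using assms by simp
  have [measurable_cong, simp]: "sets \<gamma> = sets borel" by (simp add: \<gamma>_def)
  have [measurable]: "g \<in> borel_measurable borel"
    using hol by (intro borel_measurable_continuous_onI holomorphic_n_imp_continuous_on)
  have [measurable]: "h \<in> borel_measurable borel" by (simp add: h_def)
  have G_int: "integrable \<gamma> (\<lambda>z. norm (g z) powr p)"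
    using g by (intro integrableI_bounded) (auto simp: fock_space_def \<gamma>_def)
  have H_int: "integrable \<gamma> (\<lambda>z. norm (h z) powr p)" and H_pos: "H > 0"
    using has_bochner_integral_gauss_monom[OF a, of p j] assms
    by (auto simp: h_def \<gamma>_def H_def has_bochner_integral_iff intro!: prod_pos divide_pos_pos Gamma_real_pos add_nonneg_pos)
  have "G \<ge> 0" by (simp add: G_def)
  have pq: "(p - 1) * q = p" using assms by (simp add: field_simps)
  \<comment> \<open>For \<open>p < 2\<close> the weight is singular at zeros of \<open>h\<close>;
    the convention \<open>0 powr a = 0\<close> makes both sides vanish there.\<close>
  have powh: "norm (h z) * norm (h z) powr (p - 2) = norm (h z) powr (p - 1)" for z
    by (cases "h z = 0") (simp_all add: powr_mult_base)
  define u where "u z = g z * cnj (h z) * of_real (norm (h z) powr (p - 2))" for z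
  have [measurable]: "u \<in> borel_measurable borel" unfolding u_def by measurable
  have norm_u: "norm (u z) = norm (g z) * norm (h z) powr (p - 1)" for z
    by (simp add: u_def norm_mult powh[symmetric] mult_ac)
  \<comment> \<open>\<open>G'\<close> is a positive upper bound for \<open>G\<close>: the
    normalisation in Young's inequality divides by it, while only \<open>G \<ge> 0\<close> is
    known.\<close>
  have key: "c * H \<le> (G' powr (1 / p)) * (H powr (1 / q))" if "G' > 0" "G' \<ge> G" for G'
  proof -
    define A where "A = G' powr (1 / p)"
    define B where "B = H powr (1 / q)"
    have AB: "A > 0" "B > 0" "A powr p = G'" "B powr q = H"
      using that H_pos assms by (simp_all add: A_def B_def powr_powr)
    \<comment> \<open>Young's inequality for the normalised factors; it yields the integrability of
      \<open>u\<close> as well as the estimate.\<close>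
    have le: "norm (u z) \<le> A * B * (norm (g z) powr p / G' / p + norm (h z) powr p / H / q)" for z
    proof -
      have "(norm (g z) / A) * (norm (h z) powr (p - 1) / B)
          \<le> (norm (g z) / A) powr p / p + (norm (h z) powr (p - 1) / B) powr q / q"
        using assms AB by (intro Youngs_inequality) auto
      also have "\<dots> = norm (g z) powr p / G' / p + norm (h z) powr p / H / q"
        using AB by (simp add: powr_divide powr_powr pq)
      finally show ?thesis using AB(1,2)
        by (simp add: norm_u pos_divide_le_eq mult_ac)
    qed
    have R_int: "integrable \<gamma> (\<lambda>z. A * B * (norm (g z) powr p / G' / p + norm (h z) powr p / H / q))"
      using G_int H_int by auto
    have u_int: "integrable \<gamma> u"
      by (rule Bochner_Integration.integrable_bound[OF R_int]) (use le in \<open>auto intro: order_trans[OF _ abs_ge_self]\<close>)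
    have sq: "(norm (h z))\<^sup>2 * norm (h z) powr (p - 2) = norm (h z) powr p" for z
      using powh[of z] by (cases "h z = 0") (simp_all add: power2_eq_square mult.assoc powr_mult_base)
    have "(\<integral>z. u z \<partial>\<gamma>) = torus_coeff j g 1 * of_real H"
      using integral_gauss_torus_invariant_monom[OF a hol, of "\<lambda>z. norm (h z) powr (p - 2)" j] u_int
      unfolding u_def \<gamma>_def H_def sq[symmetric] by (simp add: h_def)
    hence "c * H = norm (\<integral>z. u z \<partial>\<gamma>)" using H_pos by (simp add: c_def norm_mult)
    also have "\<dots> \<le> (\<integral>z. norm (u z) \<partial>\<gamma>)" by (rule integral_norm_bound)
    also have "\<dots> \<le> (\<integral>z. A * B * (norm (g z) powr p / G' / p + norm (h z) powr p / H / q) \<partial>\<gamma>)"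
      by (intro integral_mono le R_int integrable_norm u_int)
    also have "\<dots> = A * B * (G / G' / p + H / H / q)"
      using G_int H_int by (simp add: G_def H_def)
    also have "\<dots> \<le> A * B * (1 / p + 1 / q)"
      using that H_pos assms AB \<open>G \<ge> 0\<close> by (intro mult_left_mono add_mono divide_right_mono) auto
    finally show ?thesis using assms by (simp add: A_def B_def)
  qed
  have root: "c * H powr (1 / p) \<le> G' powr (1 / p)" if "G' > 0" "G' \<ge> G" for G'
  proof -
    have "H = H powr (1 / p) * H powr (1 / q)"
      using assms H_pos by (simp add: powr_add[symmetric])
    hence "c * H powr (1 / p) * H powr (1 / q) \<le> G' powr (1 / p) * H powr (1 / q)"
      using key[OF that] by (simp add: mult.assoc)
    thus ?thesis using H_pos by simp
  qed
  \<comment> \<open>After raising to the power \<open>p\<close> the bound is \<open>G'\<close>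
    itself, so that \<open>dense_ge\<close> can let \<open>G'\<close> decrease to
    \<open>G\<close>.\<close>
  have le: "(c * H powr (1 / p)) powr p \<le> G'" if "G' > G" for G'
  proof -
    have "c * H powr (1 / p) \<le> G' powr (1 / p)" using root[of G'] that \<open>G \<ge> 0\<close> by simp
    hence "(c * H powr (1 / p)) powr p \<le> (G' powr (1 / p)) powr p"
      using assms by (intro powr_mono2) (auto simp: c_def)
    thus ?thesis using that \<open>G \<ge> 0\<close> assms by (simp add: powr_powr)
  qed
  hence "(c * H powr (1 / p)) powr p \<le> G" by (rule dense_ge)
  hence "((c * H powr (1 / p)) powr p) powr (1 / p) \<le> G powr (1 / p)"
    using assms by (intro powr_mono2) auto
  hence "c * H powr (1 / p) \<le> G powr (1 / p)"
    using assms by (simp add: powr_powr c_def)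
  thus ?thesis by (simp add: c_def G_def H_def h_def \<gamma>_def fock_norm_def)
qed

section \<open>Norms and ratios of monomials\<close>

lemma fock_norm_monom:
  assumes "\<alpha> > 0" "p > 0"
  shows "fock_norm p \<alpha> (monom_fn j)
     = (\<Prod>i\<in>UNIV. Gamma (j i * p / 2 + 1) powr (1 / p) / (\<alpha> * p / 2) powr (j i / 2))"
proof -
  have "fock_norm p \<alpha> (monom_fn j)
     = (\<Prod>i\<in>UNIV. Gamma (j i * p / 2 + 1) / (\<alpha> * p / 2) powr (j i * p / 2)) powr (1 / p)"
    using has_bochner_integral_gauss_monom[of "\<alpha> * p / 2" p j] assms
    by (simp add: fock_norm_def has_bochner_integral_iff)
  also have "\<dots> = (\<Prod>i\<in>UNIV. Gamma (j i * p / 2 + 1) powr (1 / p) / (\<alpha> * p / 2) powr (j i / 2))"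
    unfolding prod_powr_distrib
  proof (rule prod.cong[OF refl])
    fix i
    have "(x / a powr (j i * p / 2)) powr (1 / p) = x powr (1 / p) / a powr (j i / 2)" if "x > 0" for x a
      using that assms by (simp add: powr_divide powr_powr)
    from this[of "Gamma (j i * p / 2 + 1)" "\<alpha> * p / 2"]
    show "(Gamma (j i * p / 2 + 1) / (\<alpha> * p / 2) powr (j i * p / 2)) powr (1 / p)
        = Gamma (j i * p / 2 + 1) powr (1 / p) / (\<alpha> * p / 2) powr (j i / 2)"
      using Gamma_real_pos[of "j i * p / 2 + 1"] assms by (simp add: add_nonneg_pos)
  qed
  finally show ?thesis .
qed

lemma fock_norm_monom_pos: "\<alpha> > 0 \<Longrightarrow> p > 0 \<Longrightarrow> fock_norm p \<alpha> (monom_fn j) > 0"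
proof -
  assume *: "\<alpha> > 0" "p > 0"
  have "Gamma (j i * p / 2 + 1) > 0" for i using * by (auto intro!: Gamma_real_pos add_nonneg_pos)
  thus ?thesis using * by (auto simp: fock_norm_monom less_imp_neq[symmetric] intro!: prod_pos divide_pos_pos)
qed

text \<open>In each coordinate the \<open>\<alpha> ^ k\<close> of the inner product cancels against
  an \<open>\<alpha> powr (k / 2)\<close> from each of the two norms.\<close>

lemma monom_ratio_eq_prod:
  assumes "\<alpha> > 0" "p > 0" "q > 0"
  shows "(\<Prod>i\<in>UNIV. fact (j i) / \<alpha> ^ j i) / (fock_norm p \<alpha> (monom_fn j) * fock_norm q \<alpha> (monom_fn j))
      = (\<Prod>i\<in>UNIV. Gamma_ratio p q (j i))"
proof -
  have "fact k / \<alpha> ^ k / ((Gamma (k * p / 2 + 1) powr (1 / p) / (\<alpha> * p / 2) powr (k / 2)) *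
      (Gamma (k * q / 2 + 1) powr (1 / q) / (\<alpha> * q / 2) powr (k / 2))) = Gamma_ratio p q k" for k
  proof -
    have 1: "(\<alpha> * r / 2) powr (k / 2) = \<alpha> powr (k / 2) * (r / 2) powr (k / 2)" if "r > 0" for r
      using that assms powr_mult[of \<alpha> "r / 2" "k / 2"] by simp
    have 2: "\<alpha> ^ k = \<alpha> powr (k / 2) * \<alpha> powr (k / 2)"
      using assms by (simp add: powr_realpow[symmetric] powr_add[symmetric])
    have "\<alpha> powr (k / 2) \<noteq> 0" using assms by simp
    thus ?thesis unfolding 1[OF assms(2)] 1[OF assms(3)] 2 Gamma_ratio_def by simp
  qed
  thus ?thesis using assms
    by (simp only: fock_norm_monom prod.distrib[symmetric] prod_dividef[symmetric])
qed

lemma monom_fn_in_fock_space: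
  assumes "\<alpha> > 0" "p > 0"
  shows "monom_fn j \<in> fock_space p \<alpha> - {\<lambda>z. 0}"
proof -
  have "monom_fn j 1 = 1" by (simp add: monom_fn_def)
  hence "monom_fn j \<noteq> (\<lambda>z. 0)" by (metis zero_neq_one)
  thus ?thesis using assms nn_integral_gauss_monom[of "\<alpha> * p / 2" p j]
    by (simp add: fock_space_def holomorphic_n_monom_fn)
qed

text \<open>The choice \<open>g = h\<close> attains the bound that \<open>ratio_R_monom_le\<close>
  passes through, so these products are the optimal values for fixed \<open>h\<close>.\<close>

lemma ratio_R_monom_self:
  assumes "\<alpha> > 0" "p > 0" "q > 0"
  shows "ratio_R p q \<alpha> (monom_fn j) (monom_fn j) = (\<Prod>i\<in>UNIV. Gamma_ratio p q (j i))"
proof -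
  have "fock_inner \<alpha> (monom_fn j) (monom_fn j) = (\<integral>z. of_real ((norm (monom_fn j z))\<^sup>2) \<partial>gauss_measure \<alpha>)"
    unfolding fock_inner_def complex_norm_square ..
  also have "\<dots> = of_real (\<integral>z. (norm (monom_fn j z))\<^sup>2 \<partial>gauss_measure \<alpha>)"
    by (rule integral_complex_of_real)
  also have "(\<integral>z. (norm (monom_fn j z))\<^sup>2 \<partial>gauss_measure \<alpha>) = (\<Prod>i\<in>UNIV. fact (j i) / \<alpha> ^ j i)"
    using assms(1) by (rule integral_gauss_monom_square)
  finally have "norm (fock_inner \<alpha> (monom_fn j) (monom_fn j)) = (\<Prod>i\<in>UNIV. fact (j i) / \<alpha> ^ j i)"
    using assms by (simp add: prod_nonneg del: of_real_prod)
  thus ?thesis unfolding ratio_R_def using monom_ratio_eq_prod[OF assms, of j] by simp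
qed

text \<open>The Fourier coefficient links two estimates: it controls the pairing, and it is at most
  the quotient of the norms of \<open>g\<close> and \<open>h\<close>. Hence \<open>g\<close> drops
  out and a product of Gamma quotients remains.\<close>

lemma ratio_R_monom_le:
  fixes g :: "complex^'n::finite \<Rightarrow> complex"
  assumes "\<alpha> > 0" "p > 1" "q > 1" "1 / p + 1 / q = 1" and g: "g \<in> fock_space p \<alpha>"
  shows "ratio_R p q \<alpha> g (monom_fn j) \<le> C_const p q powr (real CARD('n) / 2)"
proof (cases "fock_norm p \<alpha> g = 0")
  case True
  \<comment> \<open>Division by 0 makes the ratio 0.\<close>
  thus ?thesis by (simp add: ratio_R_def)
next
  case False
  hence pos: "fock_norm p \<alpha> g > 0" by (simp add: fock_norm_def)
  define N where "N = (\<Prod>i\<in>UNIV. fact (j i) / \<alpha> ^ j i)"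
  have h: "fock_norm p \<alpha> (monom_fn j) > 0" "fock_norm q \<alpha> (monom_fn j) > 0"
    using assms by (auto intro!: fock_norm_monom_pos)
  have "N \<ge> 0" using assms by (auto simp: N_def intro!: prod_nonneg)
  have "norm (fock_inner \<alpha> g (monom_fn j)) \<le> norm (torus_coeff j g 1) * N"
    using norm_fock_inner_monom_le[of \<alpha> g j] assms g by (simp add: fock_space_def N_def)
  also have "\<dots> \<le> fock_norm p \<alpha> g / fock_norm p \<alpha> (monom_fn j) * N"
    using torus_coeff_bound[OF assms, of j] h \<open>N \<ge> 0\<close>
    by (intro mult_right_mono) (simp_all add: pos_le_divide_eq)
  finally have "ratio_R p q \<alpha> g (monom_fn j) \<le> N / (fock_norm p \<alpha> (monom_fn j) * fock_norm q \<alpha> (monom_fn j))"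
    using pos h by (simp add: ratio_R_def field_simps)
  also have "\<dots> = (\<Prod>i\<in>UNIV. Gamma_ratio p q (j i))"
    unfolding N_def using assms by (intro monom_ratio_eq_prod) auto
  also have "\<dots> \<le> (\<Prod>i\<in>(UNIV::'n set). C_const p q powr (1 / 2))"
    using assms by (intro prod_mono conjI less_imp_le[OF Gamma_ratio_pos] Gamma_ratio_le) auto
  also have "\<dots> = C_const p q powr (real CARD('n) / 2)"
    using C_const_pos[of p q] assms by (simp add: powr_realpow[symmetric] powr_powr)
  finally show ?thesis .
qed

theorem theorem1p6:
  fixes \<alpha> p p' :: real
  assumes "\<alpha> > 0" and "1 < p" and "1 / p + 1 / p' = 1"
  shows "(SUP g\<in>fock_space p \<alpha> - {\<lambda>z::complex^'n::finite. 0}.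
            SUP h\<in>(monomials :: (complex^'n \<Rightarrow> complex) set). ereal (ratio_R p p' \<alpha> g h))
         = ereal (C_const p p' powr (real CARD('n) / 2))"
proof -
  \<comment> \<open>Conjugacy puts \<open>1 / p'\<close> strictly between 0 and 1, which also rules
    out \<open>p' = 0\<close>, where \<open>1 / p' = 0\<close>.\<close>
  have "1 / p > 0" "1 / p < 1" using assms(2) by simp_all
  hence "1 / p' > 0" "1 / p' < 1" using assms(3) by linarith+
  hence p': "p' > 1" by (simp add: divide_less_eq split: if_splits)
  have mon: "monomials = range (monom_fn :: ('n \<Rightarrow> nat) \<Rightarrow> _)"
    by (auto simp: monomials_def monom_fn_def[abs_def])
  show ?thesis
  proof (rule antisym)
    show "(SUP g\<in>fock_space p \<alpha> - {\<lambda>z::complex^'n. 0}. SUP h\<in>monomials. ereal (ratio_R p p' \<alpha> g h))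
         \<le> ereal (C_const p p' powr (real CARD('n) / 2))"
      unfolding mon using ratio_R_monom_le[OF assms(1,2) p' assms(3), where 'n = 'n] by (auto intro!: SUP_least)
  next
    \<comment> \<open>The same exponent \<open>k\<close> in every coordinate lets all factors
      approach \<open>C powr (1 / 2)\<close> simultaneously.\<close>
    have "(\<lambda>k. \<Prod>i\<in>(UNIV::'n set). Gamma_ratio p p' k) \<longlonglongrightarrow> (\<Prod>i\<in>(UNIV::'n set). C_const p p' powr (1 / 2))"
      using assms p' by (intro tendsto_prod Gamma_ratio_tendsto) auto
    also have "(\<Prod>i\<in>(UNIV::'n set). C_const p p' powr (1 / 2)) = C_const p p' powr (real CARD('n) / 2)"
      using C_const_pos[of p p'] assms(2) p' by (simp add: powr_realpow[symmetric] powr_powr)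
    finally have lim: "(\<lambda>k. ereal (\<Prod>i\<in>(UNIV::'n set). Gamma_ratio p p' k))
        \<longlonglongrightarrow> ereal (C_const p p' powr (real CARD('n) / 2))" by (rule tendsto_ereal)
    show "ereal (C_const p p' powr (real CARD('n) / 2))
       \<le> (SUP g\<in>fock_space p \<alpha> - {\<lambda>z::complex^'n. 0}. SUP h\<in>monomials. ereal (ratio_R p p' \<alpha> g h))"
    \<comment> \<open>Each term of the sequence is a ratio with \<open>g = h\<close>, so it lies
      below the supremum, and so does the limit.\<close>
    proof (rule LIMSEQ_le_const2[OF lim], intro exI allI impI)
      fix k :: nat
      define h where "h = (monom_fn (\<lambda>_. k) :: complex^'n \<Rightarrow> complex)"
      have "ereal (\<Prod>i\<in>(UNIV::'n set). Gamma_ratio p p' k) = ereal (ratio_R p p' \<alpha> h h)"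
        using ratio_R_monom_self[of \<alpha> p p' "\<lambda>_::'n. k"] assms p' by (simp add: h_def)
      also have "\<dots> \<le> (SUP g\<in>fock_space p \<alpha> - {\<lambda>z::complex^'n. 0}. SUP h\<in>monomials. ereal (ratio_R p p' \<alpha> g h))"
        using assms monom_fn_in_fock_space[of \<alpha> p "\<lambda>_::'n. k"]
        by (intro SUP_upper2[of h] SUP_upper) (auto simp: h_def mon)
      finally show "ereal (\<Prod>i\<in>(UNIV::'n set). Gamma_ratio p p' k)
          \<le> (SUP g\<in>fock_space p \<alpha> - {\<lambda>z::complex^'n. 0}. SUP h\<in>monomials. ereal (ratio_R p p' \<alpha> g h))" .
    qed
  qed
qed

end
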